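(* Fix $\tau\in(0,1]$, $\delta\in(0,1)$ and run exact-budget Bernstein CVaR-UCBVI for $K$ episodes in a tabular MDP with nonnegative rewards and normalized returns (as in the context). On the event $\mathcal E$ (defined in the context, on which the bounds (i)–(v) listed there hold), for every episode $k\in\{1,\dots,K\}$, $$\widehat V^{\downarrow}_{1,k}(s_1,\widehat b_k)\le\tau\,\widehat b_k\le\tau,\qquad \operatorname{Var}(Y_k\mid\mathcal F_k)\le\mathbb E[Y_k\mid\mathcal F_k]\le\tau+W_k,$$ where $Y_k=\big(\widehat b_k-\sum_{h=1}^H r_{h,k}\big)^+$ and $W_k=V_1^{\widehat\rho_k}(s_1,\widehat b_k)-\widehat V^{\downarrow}_{1,k}(s_1,\widehat b_k)$.
   Context: Model. A tabular episodic MDP has finite state space $\mathcal S$ ($|\mathcal S|=S$), finite action space $\mathcal A$ ($|\mathcal A|=A$), horizon $H$, fixed initial state $s_1$; it is run for $K$ episodes. The transition kernel $P^*$ is unknown; the conditional reward laws $R(s,a)$ are known. Given $(s_h,a_h)$, the reward $r_h\sim R(s_h,a_h)$ and next state $s_{h+1}\sim P^*(\cdot\mid s_h,a_h)$ are drawn independently. Rewards are nonnegative, and for every history-dependent policy $\pi$ the return $R(\pi):=\sum_{h=1}^H r_h$ lies in $[0,1]$ almost surely. CVaR. For $X\in[0,1]$, $\operatorname{CVaR}_\tau(X)=\max_{b\in[0,1]}\{b-\tau^{-1}\mathbb E[(b-X)^+]\}$, and $\operatorname{CVaR}^*_\tau=\sup_\pi \operatorname{CVaR}_\tau(R(\pi))$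 over history-dependent $\pi$. An augmented policy $\rho=(\rho_h)_{h\le H}$ maps (state, budget) to actions; a pair $(\rho,b)$ induces the policy playing $\rho_h(s_h,b-\sum_{t<h}r_t)$ at stage $h$, with return $R(\rho,b)$. Budgets evolve as $b_{h+1}=b_h-r_h$ from an initial budget in $[0,1]$. The shortfall values are $V_h^\rho(s,b)=\mathbb E_\rho[(b-\sum_{t=h}^H r_t)^+\mid s_h=s,b_h=b]$, $V_{H+1}^\rho(s,b)=b^+$, and $V_h^*(s,b)=\inf_\rho V_h^\rho(s,b)$. Algorithm (exact-budget Bernstein CVaR-UCBVI). Let $\mathcal F_k$ be the complete history before episode $k$. Put $N_k(s,a,s')=\sum_{i<k}\sum_{h=1}^H \mathbf 1\{(s_{h,i},a_{h,i},s_{h+1,i})=(s,a,s')\}$, $N_k(s,a)=\max\{1,\sum_{s'}N_k(s,a,s')\}$, $\widehat P_k(s'\mid s,a)=N_k(s,a,s')/N_k(s,a)$ (the zero vector if unvisited, in which case empirical expectations and variances are $0$). Let $\ell_\delta=\log(HSAK/\delta)$, $L=\max\{1,\ell_\delta\}$. Set $\widehat V^{\downarrow}_{H+1,k}(s,b)=\widehat V^{\uparrow}_{H+1,k}(s,b)=b^+$. For $h=H,\dots,1$ and all reachable residual budgets $b$: $$\widehat U^{\downarrow}_{h,k}(s,b,a)=\sum_{s'}\widehat P_k(s'\mid s,a)\,\mathbb E_{r\sim R(s,a)}[\widehat V^{\downarrow}_{h+1,k}(s',b-r)]-\mathrm{BON}_{h,k}(s,b,a),$$ $$\widehat\rho_{h,k}(s,b)\in\arg\min_{a}\widehat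 U^{\downarrow}_{h,k}(s,b,a),\qquad \widehat V^{\downarrow}_{h,k}(s,b)=\max\{\widehat U^{\downarrow}_{h,k}(s,b,\widehat\rho_{h,k}(s,b)),0\},$$ $$\widehat U^{\uparrow}_{h,k}(s,b,a)=\sum_{s'}\widehat P_k(s'\mid s,a)\,\mathbb E_{r\sim R(s,a)}[\widehat V^{\uparrow}_{h+1,k}(s',b-r)]+\mathrm{BON}_{h,k}(s,b,a),$$ $$\widehat V^{\uparrow}_{h,k}(s,b)=\min\{\widehat U^{\uparrow}_{h,k}(s,b,\widehat\rho_{h,k}(s,b)),1\},$$ with a fixed measurable tie-breaking rule, and $$\mathrm{BON}_{h,k}(s,b,a)=\sqrt{\tfrac{2\ell_\delta}{N_k(s,a)}\operatorname{Var}_{s'\sim\widehat P_k(\cdot\mid s,a)}\big(\mathbb E_{r\sim R(s,a)}\widehat V^{\downarrow}_{h+1,k}(s',b-r)\big)}$$ $$+\sqrt{\tfrac{2\ell_\delta}{N_k(s,a)}\,\mathbb E_{s'\sim\widehat P_k(\cdot\mid s,a),\,r\sim R(s,a)}\big[(\widehat V^{\uparrow}_{h+1,k}(s',b-r)-\widehat V^{\downarrow}_{h+1,k}(s',b-r))^2\big]}+\tfrac{\ell_\delta}{N_k(s,a)}.$$ Then select $\widehat b_k\in\arg\max_{b\in[0,1]}\widehat f_k(b)$, $\widehat f_k(b)=b-\tau^{-1}\widehat V^{\downarrow}_{1,k}(s_1,b)$; an $\mathcal F_k$-measurable maximizer is assumed to exist and is fixed. Episode $k$ starts at $s_1$ with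 $b_{1,k}=\widehat b_k$, plays $a_{h,k}=\widehat\rho_{h,k}(s_{h,k},b_{h,k})$, observes $r_{h,k}\sim R(s_{h,k},a_{h,k})$, $s_{h+1,k}\sim P^*(\cdot\mid s_{h,k},a_{h,k})$, and sets $b_{h+1,k}=b_{h,k}-r_{h,k}$. In particular $\mathbb E[Y_k\mid\mathcal F_k]=V_1^{\widehat\rho_k}(s_1,\widehat b_k)$. Event $\mathcal E$. Let $Y_k,W_k$ be as in the claim, $Q_K=\sum_{k=1}^K\operatorname{Var}(Y_k\mid\mathcal F_k)$, $\xi_k(s,a)=\min\{1,2HS\ell_\delta/N_k(s,a)\}$, $B_k=\sum_{h=1}^H\mathbb E_{\widehat\rho_k,\widehat b_k}[2\,\mathrm{BON}_{h,k}(s_h,b_h,a_h)+\xi_k(s_h,a_h)\mid\mathcal F_k]$ (rollout in the true MDP from $(s_1,\widehat b_k)$), $g_{h,k}(s')=\mathbb E_{r\sim R(s_{h,k},a_{h,k})}V_{h+1}^{\widehat\rho_k}(s',b_{h,k}-r)$, $\mathfrak D_K=\sum_{k=1}^K\sum_{h=1}^H\sqrt{\operatorname{Var}_{s'\sim P^*(\cdot\mid s_{h,k},a_{h,k})}(g_{h,k}(s'))/N_k(s_{h,k},a_{h,k})}$ (variance over a fresh next-state draw with realized trajectory variables fixed), and $\operatorname{Regret}^{\mathrm{RL}}_\tau(K)=\sum_{k=1}^K[\operatorname{CVaR}^*_\tau-\operatorname{CVaR}_\tau(R(\widehat\rho_k,\widehat b_k))]$. $\mathcal E$ is the event on which all of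 the following hold (it is known from prior work that this has probability at least $1-\delta$): (i) $0\le\widehat V^{\downarrow}_{h,k}(s,b)\le V_h^*(s,b)$ for all $h,k,s$ and all budgets $b$; (ii) $0\le W_k\le \mathrm e B_k$ for all $k$; (iii) $\sum_{k=1}^K B_k\le 6HL+12\sqrt{SAHKL}+6S^2AHL^2$; (iv) $\mathfrak D_K\le\sqrt{SAL(2HL+2Q_K)}$; (v) $\operatorname{Regret}^{\mathrm{RL}}_\tau(K)\le 6\mathrm e\tau^{-1}\sqrt L\,\mathfrak D_K+54\mathrm e\tau^{-1}SAHK^{1/4}L^2+74\mathrm e\tau^{-1}S^2AHL^3$. *)

theory Defs
  imports "HOL-Probability.Probability"
begin

section \<open>Tabular episodic MDPs and rollouts\<close>

text \<open>
  States and actions are finite types, so \<open>S\<close> and \<open>A\<close> of the text are \<open>CARD('s)\<close> and \<open>CARD('a)\<close>.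
  Rewards have arbitrary laws on the real line. Stages are numbered \<open>1, \<dots>, H\<close>.
\<close>

record ('s, 'a) mdp =
  tkernel :: "'s \<Rightarrow> 'a \<Rightarrow> 's pmf"
  rlaw :: "'s \<Rightarrow> 'a \<Rightarrow> real measure"
  start :: "'s"
  horizon :: nat

text \<open>A trajectory assigns to every stage \<open>t\<close> in its range the triple \<open>(s\<^sub>t, a\<^sub>t, r\<^sub>t)\<close>.\<close>

type_synonym ('s, 'a) traj = "nat \<Rightarrow> 's \<times> 'a \<times> real"

definition step_space :: "('s \<times> 'a \<times> real) measure" where
  "step_space = count_space UNIV \<Otimes>\<^sub>M count_space UNIV \<Otimes>\<^sub>M borel"

definition traj_space :: "nat set \<Rightarrow> ('s, 'a) traj measure" where
  "traj_space I = PiM I (\<lambda>_. step_space)"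

definition state_at :: "('s, 'a) traj \<Rightarrow> nat \<Rightarrow> 's" where
  "state_at x t = fst (x t)"

definition action_at :: "('s, 'a) traj \<Rightarrow> nat \<Rightarrow> 'a" where
  "action_at x t = fst (snd (x t))"

definition reward_at :: "('s, 'a) traj \<Rightarrow> nat \<Rightarrow> real" where
  "reward_at x t = snd (snd (x t))"

text \<open>
  A history-dependent (possibly randomized) policy sees the stage, the past trajectory and the
  current state.
\<close>

type_synonym ('s, 'a) policy = "nat \<Rightarrow> ('s, 'a) traj \<Rightarrow> 's \<Rightarrow> 'a pmf"

definition history_policies :: "('s::finite, 'a::finite) mdp \<Rightarrow> ('s, 'a) policy set" where
  "history_policies m =
     {\<pi>. \<forall>t\<in>{1..horizon m}. \<forall>s a. (\<lambda>x. pmf (\<pi> t x s) a) \<in> borel_measurable (traj_space {1..<t})}"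

text \<open>
  \<open>rollout m \<pi> h s n\<close> is the joint law of the trajectory on stages \<open>h, \<dots>, h + n - 1\<close> and of the state at
  stage \<open>h + n\<close>, when the interaction starts in state \<open>s\<close> at stage \<open>h\<close>.
\<close>

primrec rollout ::
  "('s::finite, 'a::finite) mdp \<Rightarrow> ('s, 'a) policy \<Rightarrow> nat \<Rightarrow> 's \<Rightarrow> nat \<Rightarrow> (('s, 'a) traj \<times> 's) measure"
where
  "rollout m \<pi> h s 0 = return (traj_space {h..<h} \<Otimes>\<^sub>M count_space UNIV) (\<lambda>_. undefined, s)"
| "rollout m \<pi> h s (Suc n) =
     rollout m \<pi> h s n \<bind> (\<lambda>(x, u).
       measure_pmf (\<pi> (h + n) x u) \<bind> (\<lambda>a.
         rlaw m u a \<bind> (\<lambda>r.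
           measure_pmf (tkernel m u a) \<bind> (\<lambda>u'.
             return (traj_space {h..<h + Suc n} \<Otimes>\<^sub>M count_space UNIV)
               (x(h + n := (u, a, r)), u')))))"

text \<open>The sum of the rewards of stages \<open>h, \<dots>, H\<close>.\<close>

definition reward_sum :: "('s, 'a) mdp \<Rightarrow> nat \<Rightarrow> ('s, 'a) traj \<times> 's \<Rightarrow> real" where
  "reward_sum m h z = (\<Sum>t=h..horizon m. reward_at (fst z) t)"

definition tabular_mdp :: "('s::finite, 'a::finite) mdp \<Rightarrow> bool" where
  "tabular_mdp m \<longleftrightarrow>
     1 \<le> horizon m \<and>
     (\<forall>s a. prob_space (rlaw m s a) \<and> sets (rlaw m s a) = sets borel \<and> (AE r in rlaw m s a. 0 \<le> r)) \<and>
     (\<forall>\<pi>\<in>history_policies m.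
        AE z in rollout m \<pi> 1 (start m) (horizon m). reward_sum m 1 z \<in> {0..1})"

section \<open>CVaR and shortfall values\<close>

text \<open>The supremum is attained for integrable \<open>f\<close>, the objective being continuous in \<open>b\<close>.\<close>

definition cvar :: "real \<Rightarrow> 'x measure \<Rightarrow> ('x \<Rightarrow> real) \<Rightarrow> real" where
  "cvar \<tau> M f = (SUP b\<in>{0..1}. b - 1 / \<tau> * (\<integral>x. max 0 (b - f x) \<partial>M))"

definition cvar_policy :: "('s::finite, 'a::finite) mdp \<Rightarrow> real \<Rightarrow> ('s, 'a) policy \<Rightarrow> real" where
  "cvar_policy m \<tau> \<pi> = cvar \<tau> (rollout m \<pi> 1 (start m) (horizon m)) (reward_sum m 1)"

definition cvar_opt :: "('s::finite, 'a::finite) mdp \<Rightarrow> real \<Rightarrow> real" where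
  "cvar_opt m \<tau> = (SUP \<pi>\<in>history_policies m. cvar_policy m \<tau> \<pi>)"

type_synonym ('s, 'a) aug_policy = "nat \<Rightarrow> 's \<Rightarrow> real \<Rightarrow> 'a"

definition aug_policies :: "('s, 'a) mdp \<Rightarrow> ('s, 'a) aug_policy set" where
  "aug_policies m = {\<rho>. \<forall>h\<in>{1..horizon m}. \<forall>s. \<rho> h s \<in> measurable borel (count_space UNIV)}"

text \<open>The policy induced from stage \<open>h\<close> on by an augmented policy with budget \<open>b\<close> at stage \<open>h\<close>.\<close>

definition induced :: "('s, 'a) aug_policy \<Rightarrow> nat \<Rightarrow> real \<Rightarrow> ('s, 'a) policy" where
  "induced \<rho> h b = (\<lambda>t x s. return_pmf (\<rho> t s (b - (\<Sum>u=h..<t. reward_at x u))))"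

definition sf_value ::
  "('s::finite, 'a::finite) mdp \<Rightarrow> ('s, 'a) aug_policy \<Rightarrow> nat \<Rightarrow> 's \<Rightarrow> real \<Rightarrow> real" where
  "sf_value m \<rho> h s b =
     (\<integral>z. max 0 (b - reward_sum m h z) \<partial>rollout m (induced \<rho> h b) h s (Suc (horizon m) - h))"

definition sf_value_opt :: "('s::finite, 'a::finite) mdp \<Rightarrow> nat \<Rightarrow> 's \<Rightarrow> real \<Rightarrow> real" where
  "sf_value_opt m h s b = (INF \<rho>\<in>aug_policies m. sf_value m \<rho> h s b)"

section \<open>Planning step of the algorithm\<close>

type_synonym ('s, 'a) counts = "'s \<Rightarrow> 'a \<Rightarrow> 's \<Rightarrow> nat"

definition visits :: "('s::finite, 'a) counts \<Rightarrow> 's \<Rightarrow> 'a \<Rightarrow> nat" where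
  "visits n s a = max 1 (\<Sum>s'\<in>UNIV. n s a s')"

text \<open>For an unvisited pair, \<open>phat\<close> is the zero vector, so that \<open>emp_mean\<close> and \<open>emp_var\<close> vanish.\<close>

definition phat :: "('s::finite, 'a) counts \<Rightarrow> 's \<Rightarrow> 'a \<Rightarrow> 's \<Rightarrow> real" where
  "phat n s a s' = real (n s a s') / real (visits n s a)"

definition emp_mean :: "('s::finite, 'a) counts \<Rightarrow> 's \<Rightarrow> 'a \<Rightarrow> ('s \<Rightarrow> real) \<Rightarrow> real" where
  "emp_mean n s a f = (\<Sum>s'\<in>UNIV. phat n s a s' * f s')"

definition emp_var :: "('s::finite, 'a) counts \<Rightarrow> 's \<Rightarrow> 'a \<Rightarrow> ('s \<Rightarrow> real) \<Rightarrow> real" where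
  "emp_var n s a f = emp_mean n s a (\<lambda>s'. (f s' - emp_mean n s a f)\<^sup>2)"

text \<open>
  In \<open>bonus\<close>, \<open>q_down\<close>, \<open>q_up\<close> below, \<open>l\<close> stands for \<open>\<ell>\<^sub>\<delta>\<close>, and \<open>D\<close>, \<open>U\<close> for the lower and upper values of
  the following stage, as functions of state and budget.
\<close>

definition bonus ::
  "('s::finite, 'a) mdp \<Rightarrow> real \<Rightarrow> ('s, 'a) counts \<Rightarrow> ('s \<Rightarrow> real \<Rightarrow> real) \<Rightarrow> ('s \<Rightarrow> real \<Rightarrow> real)
    \<Rightarrow> 's \<Rightarrow> real \<Rightarrow> 'a \<Rightarrow> real" where
  "bonus m l n D U s b a =
     sqrt (2 * l / real (visits n s a) * emp_var n s a (\<lambda>s'. \<integral>r. D s' (b - r) \<partial>rlaw m s a))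
     + sqrt (2 * l / real (visits n s a)
         * emp_mean n s a (\<lambda>s'. \<integral>r. (U s' (b - r) - D s' (b - r))\<^sup>2 \<partial>rlaw m s a))
     + l / real (visits n s a)"

definition q_down ::
  "('s::finite, 'a) mdp \<Rightarrow> real \<Rightarrow> ('s, 'a) counts \<Rightarrow> ('s \<Rightarrow> real \<Rightarrow> real) \<Rightarrow> ('s \<Rightarrow> real \<Rightarrow> real)
    \<Rightarrow> 's \<Rightarrow> real \<Rightarrow> 'a \<Rightarrow> real" where
  "q_down m l n D U s b a =
     emp_mean n s a (\<lambda>s'. \<integral>r. D s' (b - r) \<partial>rlaw m s a) - bonus m l n D U s b a"

definition q_up ::
  "('s::finite, 'a) mdp \<Rightarrow> real \<Rightarrow> ('s, 'a) counts \<Rightarrow> ('s \<Rightarrow> real \<Rightarrow> real) \<Rightarrow> ('s \<Rightarrow> real \<Rightarrow> real)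
    \<Rightarrow> 's \<Rightarrow> real \<Rightarrow> 'a \<Rightarrow> real" where
  "q_up m l n D U s b a =
     emp_mean n s a (\<lambda>s'. \<integral>r. U s' (b - r) \<partial>rlaw m s a) + bonus m l n D U s b a"

text \<open>
  The pair (lower values, upper values) with \<open>j\<close> stages to go, that is, at stage \<open>H + 1 - j\<close>. The
  policy \<open>\<rho>\<close> is a parameter here; that it consists of minimizers of the lower \<open>U\<close>-values is part of
  \<open>cvar_ucbvi_run\<close> below.
\<close>

primrec value_bounds ::
  "('s::finite, 'a) mdp \<Rightarrow> real \<Rightarrow> ('s, 'a) counts \<Rightarrow> ('s, 'a) aug_policy \<Rightarrow> nat
    \<Rightarrow> ('s \<Rightarrow> real \<Rightarrow> real) \<times> ('s \<Rightarrow> real \<Rightarrow> real)" where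
  "value_bounds m l n \<rho> 0 = (\<lambda>s b. max 0 b, \<lambda>s b. max 0 b)"
| "value_bounds m l n \<rho> (Suc j) =
     (let D = fst (value_bounds m l n \<rho> j); U = snd (value_bounds m l n \<rho> j); h = horizon m - j
      in (\<lambda>s b. max (q_down m l n D U s b (\<rho> h s b)) 0,
          \<lambda>s b. min (q_up m l n D U s b (\<rho> h s b)) 1))"

section \<open>Runs of the algorithm\<close>

text \<open>
  Episodes are numbered from \<open>1\<close>, and the first two arguments of \<open>st\<close>, \<open>ac\<close>, \<open>rw\<close> are the episode and
  the stage. \<open>bhat\<close> and \<open>rhohat\<close> are the initial budgets and augmented policies chosen by the algorithm.
\<close>

record ('w, 's, 'a) run =
  pspace :: "'w measure"
  st :: "nat \<Rightarrow> nat \<Rightarrow> 'w \<Rightarrow> 's"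
  ac :: "nat \<Rightarrow> nat \<Rightarrow> 'w \<Rightarrow> 'a"
  rw :: "nat \<Rightarrow> nat \<Rightarrow> 'w \<Rightarrow> real"
  bhat :: "nat \<Rightarrow> 'w \<Rightarrow> real"
  rhohat :: "nat \<Rightarrow> 'w \<Rightarrow> ('s, 'a) aug_policy"

definition budget :: "('w, 's, 'a) run \<Rightarrow> nat \<Rightarrow> nat \<Rightarrow> 'w \<Rightarrow> real" where
  "budget X k h w = bhat X k w - (\<Sum>t=1..<h. rw X k t w)"

text \<open>
  The sigma-algebra generated by the transitions \<open>(s, a, r, s')\<close> with (episode, stage) in \<open>I\<close>.
\<close>

definition hist_algebra :: "('w, 's, 'a) run \<Rightarrow> (nat \<times> nat) set \<Rightarrow> 'w measure" where
  "hist_algebra X I =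
     vimage_algebra (space (pspace X))
       (\<lambda>w. \<lambda>i\<in>I. (st X (fst i) (snd i) w, ac X (fst i) (snd i) w, rw X (fst i) (snd i) w,
                      st X (fst i) (Suc (snd i)) w))
       (PiM I (\<lambda>_. count_space UNIV \<Otimes>\<^sub>M count_space UNIV \<Otimes>\<^sub>M borel \<Otimes>\<^sub>M count_space UNIV))"

text \<open>
  \<open>hist_before m X k\<close> is \<open>\<F>\<^sub>k\<close>. \<open>hist_stage m X k h\<close> is generated by everything that happened before the draw of
  \<open>(r\<^sub>h, s\<^sub>h\<^sub>+\<^sub>1)\<close> in episode \<open>k\<close>; in a run, the state and the action of stage \<open>h\<close> are measurable with respect to it.
\<close>

definition hist_before :: "('s, 'a) mdp \<Rightarrow> ('w, 's, 'a) run \<Rightarrow> nat \<Rightarrow> 'w measure" where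
  "hist_before m X k = hist_algebra X ({1..<k} \<times> {1..horizon m})"

definition hist_stage :: "('s, 'a) mdp \<Rightarrow> ('w, 's, 'a) run \<Rightarrow> nat \<Rightarrow> nat \<Rightarrow> 'w measure" where
  "hist_stage m X k h = hist_algebra X ({1..<k} \<times> {1..horizon m} \<union> {k} \<times> {1..<h})"

definition cnt :: "('s, 'a) mdp \<Rightarrow> ('w, 's, 'a) run \<Rightarrow> nat \<Rightarrow> 'w \<Rightarrow> ('s, 'a) counts" where
  "cnt m X k w s a s' =
     (\<Sum>i=1..<k. \<Sum>h=1..horizon m.
        of_bool (st X i h w = s \<and> ac X i h w = a \<and> st X i (Suc h) w = s'))"

definition ell :: "('s::finite, 'a::finite) mdp \<Rightarrow> nat \<Rightarrow> real \<Rightarrow> real" where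
  "ell m K \<delta> = ln (real (horizon m * CARD('s) * CARD('a) * K) / \<delta>)"

definition v_down :: "('s::finite, 'a::finite) mdp \<Rightarrow> nat \<Rightarrow> real \<Rightarrow> ('w, 's, 'a) run
    \<Rightarrow> nat \<Rightarrow> nat \<Rightarrow> 'w \<Rightarrow> 's \<Rightarrow> real \<Rightarrow> real" where
  "v_down m K \<delta> X h k w =
     fst (value_bounds m (ell m K \<delta>) (cnt m X k w) (rhohat X k w) (Suc (horizon m) - h))"

definition v_up :: "('s::finite, 'a::finite) mdp \<Rightarrow> nat \<Rightarrow> real \<Rightarrow> ('w, 's, 'a) run
    \<Rightarrow> nat \<Rightarrow> nat \<Rightarrow> 'w \<Rightarrow> 's \<Rightarrow> real \<Rightarrow> real" where
  "v_up m K \<delta> X h k w =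
     snd (value_bounds m (ell m K \<delta>) (cnt m X k w) (rhohat X k w) (Suc (horizon m) - h))"

definition bon :: "('s::finite, 'a::finite) mdp \<Rightarrow> nat \<Rightarrow> real \<Rightarrow> ('w, 's, 'a) run
    \<Rightarrow> nat \<Rightarrow> nat \<Rightarrow> 'w \<Rightarrow> 's \<Rightarrow> real \<Rightarrow> 'a \<Rightarrow> real" where
  "bon m K \<delta> X h k w =
     bonus m (ell m K \<delta>) (cnt m X k w) (v_down m K \<delta> X (Suc h) k w) (v_up m K \<delta> X (Suc h) k w)"

definition u_down :: "('s::finite, 'a::finite) mdp \<Rightarrow> nat \<Rightarrow> real \<Rightarrow> ('w, 's, 'a) run
    \<Rightarrow> nat \<Rightarrow> nat \<Rightarrow> 'w \<Rightarrow> 's \<Rightarrow> real \<Rightarrow> 'a \<Rightarrow> real" where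
  "u_down m K \<delta> X h k w =
     q_down m (ell m K \<delta>) (cnt m X k w) (v_down m K \<delta> X (Suc h) k w) (v_up m K \<delta> X (Suc h) k w)"

definition f_hat :: "('s::finite, 'a::finite) mdp \<Rightarrow> nat \<Rightarrow> real \<Rightarrow> real \<Rightarrow> ('w, 's, 'a) run
    \<Rightarrow> nat \<Rightarrow> 'w \<Rightarrow> real \<Rightarrow> real" where
  "f_hat m K \<tau> \<delta> X k w b = b - 1 / \<tau> * v_down m K \<delta> X 1 k w (start m) b"

text \<open>
  Budgets start in \<open>[0, 1]\<close> and decrease by nonnegative rewards, so the residual budgets of the algorithm
  are taken from \<open>{..1}\<close>. The tie-breaking rule may depend on history, stage, state and budget, as long as the
  resulting action is jointly measurable in history and budget. The last clause says that, given the past,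
  the reward and the next state are independent draws from \<open>R(s\<^sub>h, a\<^sub>h)\<close> and \<open>P\<^sup>*(\<cdot> | s\<^sub>h, a\<^sub>h)\<close>.
\<close>

definition cvar_ucbvi_run ::
  "('s::finite, 'a::finite) mdp \<Rightarrow> nat \<Rightarrow> real \<Rightarrow> real \<Rightarrow> ('w, 's, 'a) run \<Rightarrow> bool" where
  "cvar_ucbvi_run m K \<tau> \<delta> X \<longleftrightarrow>
     prob_space (pspace X) \<and>
     (\<forall>k\<in>{1..K}.
        (\<forall>h\<in>{1..Suc (horizon m)}. st X k h \<in> measurable (pspace X) (count_space UNIV)) \<and>
        (\<forall>h\<in>{1..horizon m}. ac X k h \<in> measurable (pspace X) (count_space UNIV)
           \<and> rw X k h \<in> borel_measurable (pspace X)) \<and>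
        (\<forall>w\<in>space (pspace X). \<forall>h\<in>{1..horizon m}. \<forall>s. \<forall>b\<in>{..1}. \<forall>a.
           u_down m K \<delta> X h k w s b (rhohat X k w h s b) \<le> u_down m K \<delta> X h k w s b a) \<and>
        (\<forall>h\<in>{1..horizon m}. \<forall>s.
           (\<lambda>(w, b). rhohat X k w h s b)
             \<in> measurable (hist_before m X k \<Otimes>\<^sub>M borel) (count_space UNIV)) \<and>
        bhat X k \<in> borel_measurable (hist_before m X k) \<and>
        (\<forall>w\<in>space (pspace X). bhat X k w \<in> {0..1} \<and>
           (\<forall>b\<in>{0..1}. f_hat m K \<tau> \<delta> X k w b \<le> f_hat m K \<tau> \<delta> X k w (bhat X k w))) \<and>
        (\<forall>w\<in>space (pspace X). st X k 1 w = start m) \<and>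
        (\<forall>w\<in>space (pspace X). \<forall>h\<in>{1..horizon m}.
           ac X k h w = rhohat X k w h (st X k h w) (budget X k h w)) \<and>
        (\<forall>h\<in>{1..horizon m}. \<forall>B\<in>sets borel. \<forall>s'.
           AE w in pspace X.
             real_cond_exp (pspace X) (hist_stage m X k h)
               (\<lambda>v. of_bool (rw X k h v \<in> B \<and> st X k (Suc h) v = s')) w
             = measure (rlaw m (st X k h w) (ac X k h w)) B
               * pmf (tkernel m (st X k h w) (ac X k h w)) s'))"

section \<open>The quantities of the analysis and the event\<close>

definition cond_var :: "'w measure \<Rightarrow> 'w measure \<Rightarrow> ('w \<Rightarrow> real) \<Rightarrow> 'w \<Rightarrow> real" where
  "cond_var M F f = real_cond_exp M F (\<lambda>w. (f w - real_cond_exp M F f w)\<^sup>2)"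

definition shortfall :: "('s, 'a) mdp \<Rightarrow> ('w, 's, 'a) run \<Rightarrow> nat \<Rightarrow> 'w \<Rightarrow> real" where
  "shortfall m X k w = max 0 (bhat X k w - (\<Sum>h=1..horizon m. rw X k h w))"

definition val_gap :: "('s::finite, 'a::finite) mdp \<Rightarrow> nat \<Rightarrow> real \<Rightarrow> ('w, 's, 'a) run
    \<Rightarrow> nat \<Rightarrow> 'w \<Rightarrow> real" where
  "val_gap m K \<delta> X k w =
     sf_value m (rhohat X k w) 1 (start m) (bhat X k w) - v_down m K \<delta> X 1 k w (start m) (bhat X k w)"

definition var_sum :: "('s::finite, 'a::finite) mdp \<Rightarrow> nat \<Rightarrow> ('w, 's, 'a) run \<Rightarrow> 'w \<Rightarrow> real" where
  "var_sum m K X w = (\<Sum>k=1..K. cond_var (pspace X) (hist_before m X k) (shortfall m X k) w)"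

definition xi :: "('s::finite, 'a::finite) mdp \<Rightarrow> nat \<Rightarrow> real \<Rightarrow> ('w, 's, 'a) run
    \<Rightarrow> nat \<Rightarrow> 'w \<Rightarrow> 's \<Rightarrow> 'a \<Rightarrow> real" where
  "xi m K \<delta> X k w s a =
     min 1 (2 * real (horizon m) * real CARD('s) * ell m K \<delta> / real (visits (cnt m X k w) s a))"

definition bonus_sum :: "('s::finite, 'a::finite) mdp \<Rightarrow> nat \<Rightarrow> real \<Rightarrow> ('w, 's, 'a) run
    \<Rightarrow> nat \<Rightarrow> 'w \<Rightarrow> real" where
  "bonus_sum m K \<delta> X k w =
     (\<Sum>h=1..horizon m.
        \<integral>z. 2 * bon m K \<delta> X h k w (state_at (fst z) h)
                 (bhat X k w - (\<Sum>t=1..<h. reward_at (fst z) t)) (action_at (fst z) h)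
             + xi m K \<delta> X k w (state_at (fst z) h) (action_at (fst z) h)
        \<partial>rollout m (induced (rhohat X k w) 1 (bhat X k w)) 1 (start m) (horizon m))"

definition next_val :: "('s::finite, 'a::finite) mdp \<Rightarrow> ('w, 's, 'a) run
    \<Rightarrow> nat \<Rightarrow> nat \<Rightarrow> 'w \<Rightarrow> 's \<Rightarrow> real" where
  "next_val m X h k w s' =
     (\<integral>r. sf_value m (rhohat X k w) (Suc h) s' (budget X k h w - r) \<partial>rlaw m (st X k h w) (ac X k h w))"

definition dev_sum :: "('s::finite, 'a::finite) mdp \<Rightarrow> nat \<Rightarrow> ('w, 's, 'a) run \<Rightarrow> 'w \<Rightarrow> real" where
  "dev_sum m K X w =
     (\<Sum>k=1..K. \<Sum>h=1..horizon m.
        sqrt (measure_pmf.variance (tkernel m (st X k h w) (ac X k h w)) (next_val m X h k w)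
              / real (visits (cnt m X k w) (st X k h w) (ac X k h w))))"

definition regret :: "('s::finite, 'a::finite) mdp \<Rightarrow> nat \<Rightarrow> real \<Rightarrow> ('w, 's, 'a) run \<Rightarrow> 'w \<Rightarrow> real" where
  "regret m K \<tau> X w =
     (\<Sum>k=1..K. cvar_opt m \<tau> - cvar_policy m \<tau> (induced (rhohat X k w) 1 (bhat X k w)))"

definition good_event :: "('s::finite, 'a::finite) mdp \<Rightarrow> nat \<Rightarrow> real \<Rightarrow> real \<Rightarrow> ('w, 's, 'a) run
    \<Rightarrow> 'w set" where
  "good_event m K \<tau> \<delta> X =
     (let H = real (horizon m); S = real CARD('s); A = real CARD('a);
          L = max 1 (ell m K \<delta>); e = exp (1::real)
      in {w \<in> space (pspace X).
        (\<forall>h\<in>{1..horizon m}. \<forall>k\<in>{1..K}. \<forall>s. \<forall>b\<in>{..1}.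
           0 \<le> v_down m K \<delta> X h k w s b \<and> v_down m K \<delta> X h k w s b \<le> sf_value_opt m h s b) \<and>
        (\<forall>k\<in>{1..K}. 0 \<le> val_gap m K \<delta> X k w \<and> val_gap m K \<delta> X k w \<le> e * bonus_sum m K \<delta> X k w) \<and>
        (\<Sum>k=1..K. bonus_sum m K \<delta> X k w)
          \<le> 6 * H * L + 12 * sqrt (S * A * H * real K * L) + 6 * S\<^sup>2 * A * H * L\<^sup>2 \<and>
        dev_sum m K X w \<le> sqrt (S * A * L * (2 * H * L + 2 * var_sum m K X w)) \<and>
        regret m K \<tau> X w
          \<le> 6 * e / \<tau> * sqrt L * dev_sum m K X w
            + 54 * e / \<tau> * S * A * H * real K powr (1 / 4) * L\<^sup>2
            + 74 * e / \<tau> * S\<^sup>2 * A * H * L ^ 3})"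

end

theory Submission
  imports Defs
begin

text \<open>
  With initial budget \<open>0\<close> the shortfall vanishes, so optimism gives a nonpositive lower value there;
  comparing the maximizer \<open>bhat\<close> of \<open>f_hat\<close> with \<open>b = 0\<close> bounds the lower value by \<open>\<tau> * bhat\<close>. Conditionally
  on the past, the episode is distributed as the rollout of the chosen augmented policy, by induction
  on the stage from the conditional law of reward and next state. Hence the conditional mean
  of the shortfall is the value of that policy, that is, the lower value plus the gap. The variance
  bound is the usual one for random variables with values in \<open>[0, 1]\<close>.
\<close>

text \<open>The run does not come as a composition of kernels: it only prescribes, for each Borel
  set and each next state separately, a conditional probability up to a null set. Instead of
  conditional laws, the proof compares unconditional integrals of \<open>g (w, trajectory)\<close>,
  where \<open>g\<close> is nonnegative and jointly measurable in the information before the episode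
  and the trajectory. Keeping the sample point \<open>w\<close> as a coordinate lets the policy and
  the initial budget, which are random but fixed by that information, be frozen inside a rollout.
  Taking \<open>g\<close> as the indicator of a past event times the shortfall gives back the
  defining property of conditional expectation. Taking \<open>g\<close> as the indicator of an
  abnormal return transfers to the run the normalization of returns, which is assumed for rollouts
  only.\<close>

abbreviation rollout_space :: "nat \<Rightarrow> nat \<Rightarrow> (('s, 'a) traj \<times> 's) measure" where
  "rollout_space h n \<equiv> traj_space {h..<h + n} \<Otimes>\<^sub>M count_space UNIV"

section \<open>Measurability of trajectories and the kernel of a single stage\<close>

lemma measurable_traj_component:
  assumes "t \<in> I"
  shows "(\<lambda>x. x t) \<in> measurable (traj_space I) step_space"
  using assms unfolding traj_space_def by (rule measurable_component_singleton)

lemma measurable_reward_at [measurable (raw)]: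
  assumes f: "f \<in> measurable M (traj_space I)" and t: "t \<in> I"
  shows "(\<lambda>w. reward_at (f w) t) \<in> borel_measurable M"
proof -
  have [measurable]: "(\<lambda>w. f w t) \<in> measurable M step_space"
    using measurable_compose[OF f measurable_traj_component[OF t]] .
  then show ?thesis unfolding reward_at_def step_space_def by measurable
qed

lemma measurable_traj_upd:
  assumes "f \<in> measurable M (traj_space I)" "g \<in> measurable M step_space"
  shows "(\<lambda>w. (f w)(i := g w)) \<in> measurable M (traj_space (insert i I))"
proof -
  have "(\<lambda>w. (f w, g w)) \<in> measurable M (PiM I (\<lambda>_. step_space) \<Otimes>\<^sub>M step_space)"
    using assms unfolding traj_space_def by measurable
  from measurable_compose[OF this measurable_add_dim[where I=I and M="\<lambda>_. step_space" and i=i]]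
  show ?thesis by (simp add: traj_space_def)
qed

definition reward_law :: "('s, 'a) mdp \<Rightarrow> bool" where
  "reward_law m \<longleftrightarrow> (\<forall>s a. prob_space (rlaw m s a) \<and> sets (rlaw m s a) = sets borel)"

lemma reward_law_rlaw:
  assumes "reward_law m"
  shows "rlaw m s a \<in> space (prob_algebra borel)"
  using assms by (auto simp: reward_law_def space_prob_algebra)

text \<open>The part of a stage that follows the choice of the action. With the action as an
  argument, the kernel can be studied apart from the rule that selects it.\<close>

definition step_kernel ::
  "('s::finite, 'a::finite) mdp \<Rightarrow> nat \<Rightarrow> nat \<Rightarrow> ('s, 'a) traj \<times> 's \<Rightarrow> 'a \<Rightarrow> (('s, 'a) traj \<times> 's) measure"
where
  "step_kernel m h n z a =
     rlaw m (snd z) a \<bind> (\<lambda>r. measure_pmf (tkernel m (snd z) a) \<bind>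
       (\<lambda>u. return (rollout_space h (Suc n)) ((fst z)(h + n := (snd z, a, r)), u)))"

lemma measurable_extend:
  assumes [measurable]: "x \<in> measurable M (traj_space {h..<h + n})" "r \<in> borel_measurable M"
    "u \<in> measurable M (count_space UNIV)" "s \<in> measurable M (count_space UNIV)" "a \<in> measurable M (count_space UNIV)"
  shows "(\<lambda>w. ((x w)(h + n := (s w, a w, r w)), u w)) \<in> measurable M (rollout_space h (Suc n))"
proof -
  have "{h..<h + Suc n} = insert (h + n) {h..<h + n}" by auto
  moreover have "(\<lambda>w. (s w, a w, r w)) \<in> measurable M step_space"
    unfolding step_space_def by measurable
  ultimately have [measurable]: "(\<lambda>w. (x w)(h + n := (s w, a w, r w)))
      \<in> measurable M (traj_space {h..<h + Suc n})"
    using measurable_traj_upd[of x M "{h..<h + n}"] by simp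
  show ?thesis by measurable
qed

lemma measurable_step_kernel:
  assumes m: "reward_law m" and z: "z \<in> measurable M (rollout_space h n)"
    and a: "a \<in> measurable M (count_space UNIV)"
  shows "(\<lambda>w. step_kernel m h n (z w) (a w)) \<in> measurable M (prob_algebra (rollout_space h (Suc n)))"
proof -
  have fz[measurable]: "(\<lambda>w. fst (z w)) \<in> measurable M (traj_space {h..<h + n})"
    using z by measurable
  have sz: "(\<lambda>w. snd (z w)) \<in> measurable M (count_space UNIV)"
    using z by measurable
  define K where "K s b w = rlaw m s b \<bind> (\<lambda>r. measure_pmf (tkernel m s b) \<bind>
       (\<lambda>u. return (rollout_space h (Suc n)) ((fst (z w))(h + n := (s, b, r)), u)))" for s b w
  have K: "K s b \<in> measurable M (prob_algebra (rollout_space h (Suc n)))" for s b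
  proof -
    have e: "(\<lambda>p. ((fst (z (fst (fst p))))(h + n := (s, b, snd (fst p))), snd p))
      \<in> measurable ((M \<Otimes>\<^sub>M borel) \<Otimes>\<^sub>M count_space UNIV) (rollout_space h (Suc n))"
      by (rule measurable_extend) measurable
    have i: "(\<lambda>p. measure_pmf (tkernel m s b) \<bind>
       (\<lambda>u. return (rollout_space h (Suc n)) ((fst (z (fst p)))(h + n := (s, b, snd p)), u)))
       \<in> measurable (M \<Otimes>\<^sub>M borel) (prob_algebra (rollout_space h (Suc n)))"
    proof (rule measurable_bind_prob_space2[where N="count_space UNIV"])
      show "(\<lambda>x. measure_pmf (tkernel m s b)) \<in> M \<Otimes>\<^sub>M borel \<rightarrow>\<^sub>M prob_algebra (count_space UNIV)"
        by (rule measurable_const) (simp add: space_prob_algebra prob_space_measure_pmf)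
      show "(\<lambda>(x, y). return (rollout_space h (Suc n)) ((fst (z (fst x)))(h + n := (s, b, snd x)), y))
        \<in> (M \<Otimes>\<^sub>M borel) \<Otimes>\<^sub>M count_space UNIV \<rightarrow>\<^sub>M prob_algebra (rollout_space h (Suc n))"
        using measurable_compose[OF e measurable_return_prob_space] by (simp add: split_def)
    qed
    show ?thesis unfolding K_def
    proof (rule measurable_bind_prob_space2[where N=borel])
      show "(\<lambda>x. rlaw m s b) \<in> M \<rightarrow>\<^sub>M prob_algebra borel"
        by (rule measurable_const) (rule reward_law_rlaw[OF m])
    qed (use i in \<open>simp add: split_def\<close>)
  qed
  have "(\<lambda>w. K (snd (z w)) (a w) w) \<in> measurable M (prob_algebra (rollout_space h (Suc n)))"
    by (rule measurable_compose_countable[OF measurable_compose_countable[OF K a] sz])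
  then show ?thesis by (simp add: K_def step_kernel_def)
qed

lemma nn_integral_step_kernel:
  assumes m: "reward_law m" and z: "z \<in> space (rollout_space h n)"
    and g: "g \<in> borel_measurable (rollout_space h (Suc n))"
  shows "(\<integral>\<^sup>+y. g y \<partial>step_kernel m h n z a) =
    (\<integral>\<^sup>+r. \<integral>\<^sup>+u. g ((fst z)(h + n := (snd z, a, r)), u) \<partial>tkernel m (snd z) a \<partial>rlaw m (snd z) a)"
proof -
  have z1[measurable]: "fst z \<in> space (traj_space {h..<h + n})"
    using z by (auto simp: space_pair_measure)
  have sb[measurable_cong]: "sets (rlaw m s a) = sets borel" for s
    using m by (simp add: reward_law_def)
  have e: "(\<lambda>p. ((fst z)(h + n := (snd z, a, fst p)), snd p))
      \<in> measurable (borel \<Otimes>\<^sub>M count_space UNIV) (rollout_space h (Suc n))"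
    by (rule measurable_extend) measurable
  have e': "(\<lambda>u. ((fst z)(h + n := (snd z, a, r)), u))
      \<in> measurable (count_space UNIV) (rollout_space h (Suc n))" for r
    by (rule measurable_extend) measurable
  let ?R = "\<lambda>p. return (rollout_space h (Suc n)) ((fst z)(h + n := (snd z, a, fst p)), snd p)"
  have R: "?R \<in> measurable (borel \<Otimes>\<^sub>M count_space UNIV) (subprob_algebra (rollout_space h (Suc n)))"
    using measurable_compose[OF e return_measurable] .
  have R': "(\<lambda>u. ?R (r, u)) \<in> measurable (count_space UNIV) (subprob_algebra (rollout_space h (Suc n)))" for r
    using measurable_compose[OF e' return_measurable] by simp
  have I: "(\<lambda>r. measure_pmf (tkernel m (snd z) a) \<bind> (\<lambda>u. ?R (r, u)))
     \<in> measurable borel (subprob_algebra (rollout_space h (Suc n)))"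
  proof (rule measurable_bind[where N="count_space UNIV"])
    show "(\<lambda>r. measure_pmf (tkernel m (snd z) a)) \<in> borel \<rightarrow>\<^sub>M subprob_algebra (count_space UNIV)"
      by (rule measurable_const) (simp add: space_subprob_algebra measure_pmf.subprob_space_axioms)
  qed (use R in \<open>simp only: prod.collapse fst_conv snd_conv\<close>)
  have "(\<integral>\<^sup>+y. g y \<partial>step_kernel m h n z a) =
    (\<integral>\<^sup>+r. (\<integral>\<^sup>+y. g y \<partial>(measure_pmf (tkernel m (snd z) a) \<bind> (\<lambda>u. ?R (r, u)))) \<partial>rlaw m (snd z) a)"
    unfolding step_kernel_def fst_conv snd_conv
    by (rule nn_integral_bind[OF g]) (subst measurable_cong_sets[OF sb refl], rule I[unfolded fst_conv snd_conv])
  also have "\<dots> = (\<integral>\<^sup>+r. (\<integral>\<^sup>+u. (\<integral>\<^sup>+y. g y \<partial>?R (r, u)) \<partial>tkernel m (snd z) a) \<partial>rlaw m (snd z) a)"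
    using R' by (intro nn_integral_cong nn_integral_bind[OF g]) simp
  also have "\<dots> = (\<integral>\<^sup>+r. \<integral>\<^sup>+u. g ((fst z)(h + n := (snd z, a, r)), u) \<partial>tkernel m (snd z) a \<partial>rlaw m (snd z) a)"
  proof (intro nn_integral_cong)
    fix r u
    have "((fst z)(h + n := (snd z, a, r)), u) \<in> space (rollout_space h (Suc n))"
      using measurable_space[OF e', of u r] by simp
    then show "(\<integral>\<^sup>+y. g y \<partial>?R (r, u)) = g ((fst z)(h + n := (snd z, a, r)), u)"
      using g by (simp add: nn_integral_return)
  qed
  finally show ?thesis .
qed

section \<open>Rollouts of augmented policies as parametrized kernels\<close>

definition next_action :: "('s, 'a) aug_policy \<Rightarrow> nat \<Rightarrow> real \<Rightarrow> nat \<Rightarrow> ('s, 'a) traj \<times> 's \<Rightarrow> 'a" where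
  "next_action \<rho> h b n z = \<rho> (h + n) (snd z) (b - (\<Sum>t=h..<h + n. reward_at (fst z) t))"

text \<open>An induced policy plays a point mass, so the bind over actions in \<open>rollout\<close>
  collapses to a single step kernel. The hypothesis on the sigma-algebra places \<open>z\<close> in
  the space on which that kernel is measurable.\<close>

lemma rollout_induced_Suc:
  assumes m: "reward_law m" and s: "sets (rollout m (induced \<rho> h b) h s n) = sets (rollout_space h n)"
  shows "rollout m (induced \<rho> h b) h s (Suc n) =
    rollout m (induced \<rho> h b) h s n \<bind> (\<lambda>z. step_kernel m h n z (next_action \<rho> h b n z))"
  unfolding rollout.simps
proof (rule bind_cong[OF refl])
  fix z assume "z \<in> space (rollout m (induced \<rho> h b) h s n)"
  then have z: "z \<in> space (rollout_space h n)" using sets_eq_imp_space_eq[OF s] by simp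
  obtain x u where xu: "z = (x, u)" by (cases z)
  have "(\<lambda>a. step_kernel m h n z a) \<in> measurable (count_space UNIV) (subprob_algebra (rollout_space h (Suc n)))"
    by (rule measurable_prob_algebraD[OF measurable_step_kernel[OF m]]) (use z in auto)
  then have "return (count_space UNIV) (next_action \<rho> h b n z) \<bind> step_kernel m h n z
     = step_kernel m h n z (next_action \<rho> h b n z)"
    by (rule bind_return) simp
  then show "(case z of (x, u) \<Rightarrow>
        measure_pmf (induced \<rho> h b (h + n) x u) \<bind> (\<lambda>a. rlaw m u a \<bind> (\<lambda>r.
           measure_pmf (tkernel m u a) \<bind> (\<lambda>u'. return (rollout_space h (Suc n)) (x(h + n := (u, a, r)), u')))))
      = step_kernel m h n z (next_action \<rho> h b n z)"
    by (simp add: xu induced_def next_action_def step_kernel_def[abs_def] return_pmf.rep_eq)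
qed

lemma measurable_next_action:
  assumes \<rho>: "\<And>s. (\<lambda>(w, b). \<rho> w (h + n) s b) \<in> measurable (F \<Otimes>\<^sub>M borel) (count_space UNIV)"
    and [measurable]: "\<beta> \<in> borel_measurable F"
    and f[measurable]: "f \<in> measurable M F" and z[measurable]: "z \<in> measurable M (rollout_space h n)"
  shows "(\<lambda>v. next_action (\<rho> (f v) :: ('s::finite, 'a::finite) aug_policy) h (\<beta> (f v)) n (z v)) \<in> measurable M (count_space UNIV)"
proof -
  have [measurable]: "(\<lambda>v. fst (z v)) \<in> measurable M (traj_space {h..<h + n})" by measurable
  have [measurable]: "(\<lambda>v. \<Sum>t=h..<h + n. reward_at (fst (z v)) t) \<in> borel_measurable M"
    by (rule borel_measurable_sum) measurable
  have "(\<lambda>v. (f v, \<beta> (f v) - (\<Sum>t=h..<h + n. reward_at (fst (z v)) t))) \<in> measurable M (F \<Otimes>\<^sub>M borel)"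
    by measurable
  from measurable_compose[OF this \<rho>]
  have 1: "(\<lambda>v. \<rho> (f v) (h + n) s (\<beta> (f v) - (\<Sum>t=h..<h + n. reward_at (fst (z v)) t)))
    \<in> measurable M (count_space UNIV)" for s by simp
  show ?thesis unfolding next_action_def
    by (rule measurable_compose_countable[where g="\<lambda>v. snd (z v)", OF 1]) measurable
qed

text \<open>Policy and initial budget may depend on a parameter \<open>w\<close>, as those of the
  algorithm depend on the past. Joint measurability of the actions in parameter and budget makes the
  rollout a Markov kernel from the parameter space.\<close>

lemma measurable_rollout:
  assumes m: "reward_law m"
    and \<rho>: "\<And>t s. t \<in> {h..<h + n} \<Longrightarrow> (\<lambda>(w, b). \<rho> w t s b) \<in> measurable (F \<Otimes>\<^sub>M borel) (count_space UNIV)"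
    and \<beta>: "\<beta> \<in> borel_measurable F"
  shows "(\<lambda>w. rollout m (induced (\<rho> w) h (\<beta> w)) h s n) \<in> measurable F (prob_algebra (rollout_space h n))"
  using \<rho>
proof (induction n)
  case 0
  show ?case
    by (auto intro!: measurable_const prob_space_return
        simp: space_prob_algebra traj_space_def space_pair_measure space_PiM)
next
  case (Suc n)
  have IH: "(\<lambda>w. rollout m (induced (\<rho> w) h (\<beta> w)) h s n) \<in> measurable F (prob_algebra (rollout_space h n))"
    by (rule Suc.IH, rule Suc.prems) auto
  have *: "(\<lambda>(w, z). step_kernel m h n z (next_action (\<rho> w) h (\<beta> w) n z))
      \<in> measurable (F \<Otimes>\<^sub>M rollout_space h n) (prob_algebra (rollout_space h (Suc n)))"
    unfolding split_def
    by (intro measurable_step_kernel[OF m] measurable_next_action[where F=F and \<rho>=\<rho> and \<beta>=\<beta>] Suc.prems \<beta>) auto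
  have "rollout m (induced (\<rho> w) h (\<beta> w)) h s n \<bind> (\<lambda>z. step_kernel m h n z (next_action (\<rho> w) h (\<beta> w) n z))
     = rollout m (induced (\<rho> w) h (\<beta> w)) h s (Suc n)" if "w \<in> space F" for w
    using measurable_space[OF IH that]
    by (subst rollout_induced_Suc[OF m]) (auto simp: space_prob_algebra)
  with measurable_bind_prob_space2[OF IH *] show ?case
    by (subst measurable_cong) auto
qed

section \<open>From conditional probabilities to integrals against kernels\<close>

text \<open>A disintegration. For each value \<open>u\<close> of the discrete variable, two finite
  measures on pairs (sample point, real) are compared: the joint law of \<open>(w, r w)\<close> on
  the event \<open>y w = u\<close>, and the one built from \<open>Q\<close> weighted by the mass of
  \<open>u\<close>. They agree on rectangles, hence everywhere, and the finitely many
  \<open>u\<close> are then summed.\<close>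

lemma nn_integral_conditional_draw:
  fixes q :: "'w \<Rightarrow> 's::finite pmf" and g :: "'w \<times> real \<times> 's \<Rightarrow> ennreal"
  assumes P: "prob_space P" and F: "subalgebra P F"
    and r[measurable]: "r \<in> borel_measurable P" and y[measurable]: "y \<in> measurable P (count_space UNIV)"
    and Q: "Q \<in> measurable F (prob_algebra borel)"
    and q: "\<And>u. (\<lambda>w. pmf (q w) u) \<in> borel_measurable F"
    and law: "\<And>B u. B \<in> sets borel \<Longrightarrow>
      AE w in P. real_cond_exp P F (\<lambda>v. of_bool (r v \<in> B \<and> y v = u)) w = measure (Q w) B * pmf (q w) u"
    and g: "g \<in> borel_measurable (F \<Otimes>\<^sub>M borel \<Otimes>\<^sub>M count_space UNIV)"
  shows "(\<integral>\<^sup>+w. g (w, r w, y w) \<partial>P) = (\<integral>\<^sup>+w. \<integral>\<^sup>+x. \<integral>\<^sup>+u. g (w, x, u) \<partial>q w \<partial>Q w \<partial>P)"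
proof -
  interpret P: prob_space P by fact
  interpret fms: finite_measure_subalgebra P F by unfold_locales fact
  have [simp]: "space F = space P" using F by (simp add: subalgebra_def)
  have [simp]: "space P \<in> sets F" using sets.top[of F] by simp
  have FP: "f \<in> measurable P N" if "f \<in> measurable F N" for f and N :: "'z measure"
    using measurable_from_subalg[OF F that] .
  have idF[measurable]: "(\<lambda>w. w) \<in> measurable P F"
    using F by (intro measurableI) (auto simp: subalgebra_def)
  have Q': "Q \<in> measurable F (subprob_algebra borel)" by (rule measurable_prob_algebraD[OF Q])
  have QP: "Q \<in> measurable P (subprob_algebra borel)" by (rule measurable_from_subalg[OF F Q'])
  have qP[measurable]: "(\<lambda>w. pmf (q w) u) \<in> borel_measurable P" for u by (rule measurable_from_subalg[OF F q])
  have setsQ: "sets (Q w) = sets borel" if "w \<in> space P" for w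
    using measurable_space[OF Q, of w] that by (simp add: space_prob_algebra)
  have probQ: "prob_space (Q w)" if "w \<in> space P" for w
    using measurable_space[OF Q, of w] that by (simp add: space_prob_algebra)
  \<comment> \<open>The first coordinate is the sample point itself, seen only through
    \<open>F\<close>; this keeps all information in \<open>F\<close> available to the
    integrand.\<close>
  define \<mu> where "\<mu> u = distr (density P (\<lambda>w. indicator {u} (y w))) (F \<Otimes>\<^sub>M borel) (\<lambda>w. (w, r w))" for u
  define \<kappa> where "\<kappa> w = distr (Q w) (F \<Otimes>\<^sub>M borel) (Pair w)" for w
  have \<kappa>: "\<kappa> \<in> measurable P (subprob_algebra (F \<Otimes>\<^sub>M borel))"
  proof -
    have "(\<lambda>p. (fst p, snd p)) \<in> measurable (P \<Otimes>\<^sub>M borel) (F \<Otimes>\<^sub>M borel)" by measurable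
    then show ?thesis unfolding \<kappa>_def by (intro measurable_distr2[OF _ QP]) (simp add: id_def)
  qed
  define \<nu> where "\<nu> u = density P (\<lambda>w. ennreal (pmf (q w) u)) \<bind> \<kappa>" for u
  have nne: "space P \<noteq> {}" by (rule P.not_empty)
  have sets\<nu>: "sets (\<nu> u) = sets (F \<Otimes>\<^sub>M borel)" for u
    unfolding \<nu>_def by (rule sets_bind_measurable) (simp_all add: \<kappa> nne)
  have int_\<kappa>: "(\<integral>\<^sup>+z. f z \<partial>\<kappa> w) = (\<integral>\<^sup>+x. f (w, x) \<partial>Q w)"
    if "f \<in> borel_measurable (F \<Otimes>\<^sub>M borel)" "w \<in> space P" for f w
  proof -
    have "Pair w \<in> measurable (Q w) (F \<Otimes>\<^sub>M borel)"
      using that by (simp add: measurable_cong_sets[OF setsQ refl])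
    then show ?thesis unfolding \<kappa>_def using that by (simp add: nn_integral_distr)
  qed
  have int_\<nu>: "(\<integral>\<^sup>+z. f z \<partial>\<nu> u) = (\<integral>\<^sup>+w. ennreal (pmf (q w) u) * (\<integral>\<^sup>+x. f (w, x) \<partial>Q w) \<partial>P)"
    if f: "f \<in> borel_measurable (F \<Otimes>\<^sub>M borel)" for f u
  proof -
    have "(\<lambda>w. \<integral>\<^sup>+z. f z \<partial>\<kappa> w) \<in> borel_measurable P"
      by (rule measurable_compose[OF \<kappa> nn_integral_measurable_subprob_algebra[OF f]])
    then show ?thesis unfolding \<nu>_def
      using \<kappa> by (subst nn_integral_bind[OF f]) (auto simp: nn_integral_density int_\<kappa>[OF f] intro!: nn_integral_cong)
  qed
  have int_\<mu>: "(\<integral>\<^sup>+z. f z \<partial>\<mu> u) = (\<integral>\<^sup>+w. indicator {u} (y w) * f (w, r w) \<partial>P)"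
    if [measurable]: "f \<in> borel_measurable (F \<Otimes>\<^sub>M borel)" for f u
    unfolding \<mu>_def by (subst nn_integral_distr) (auto simp: nn_integral_density)
  \<comment> \<open>Both sides are the integral over \<open>A\<close> of the conditional probability
    of the event \<open>r v \<in> B \<and> y v = u\<close>: since \<open>A\<close> lies in
    \<open>F\<close>, integrating over it removes the conditional expectation, and
    \<open>law\<close> supplies the product form.\<close>
  have rect: "emeasure (\<mu> u) (A \<times> B) = emeasure (\<nu> u) (A \<times> B)"
    if A: "A \<in> sets F" and B[measurable]: "B \<in> sets borel" for A B u
  proof -
    have [measurable]: "A \<in> sets P" using A F by (auto simp: subalgebra_def)
    have AB: "A \<times> B \<in> sets (F \<Otimes>\<^sub>M borel)" using A B by simp
    let ?f = "\<lambda>v. of_bool (r v \<in> B \<and> y v = u) :: real"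
    have i1: "integrable P ?f" by (rule P.integrable_const_bound[where B=1]) auto
    have i2: "set_integrable P A ?f" unfolding set_integrable_def
      by (rule P.integrable_const_bound[where B=1]) (auto simp: indicator_def)
    have mB[measurable]: "(\<lambda>w. measure (Q w) B) \<in> borel_measurable P"
      by (rule measurable_compose[OF QP measurable_measure_subprob_algebra]) simp
    have le1: "measure (Q w) B * pmf (q w) u \<le> 1" if "w \<in> space P" for w
      using prob_space.prob_le_1[OF probQ[OF that], of B] pmf_le_1[of "q w" u]
      by (intro mult_le_one) auto
    have i3: "integrable P (\<lambda>w. indicator A w *\<^sub>R (measure (Q w) B * pmf (q w) u))"
      by (rule P.integrable_const_bound[where B=1]) (auto simp: indicator_def le1)
    have "emeasure (\<mu> u) (A \<times> B) = (\<integral>\<^sup>+z. indicator (A \<times> B) z \<partial>\<mu> u)"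
      using AB by (subst nn_integral_indicator) (simp_all add: \<mu>_def)
    also have "\<dots> = (\<integral>\<^sup>+w. ennreal (indicator A w *\<^sub>R ?f w) \<partial>P)"
      using AB by (subst int_\<mu>) (auto intro!: nn_integral_cong simp: indicator_def)
    also have "\<dots> = ennreal (\<integral>w\<in>A. ?f w \<partial>P)"
      using i2 unfolding set_integrable_def set_lebesgue_integral_def
      by (rule nn_integral_eq_integral) auto
    also have "(\<integral>w\<in>A. ?f w \<partial>P) = (\<integral>w\<in>A. real_cond_exp P F ?f w \<partial>P)"
      by (rule fms.real_cond_exp_intA[OF i1 A])
    also have "\<dots> = (\<integral>w\<in>A. measure (Q w) B * pmf (q w) u \<partial>P)"
      unfolding set_lebesgue_integral_def using law[OF B, of u]
      by (intro integral_cong_AE) (measurable, auto)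
    also have "ennreal \<dots> = (\<integral>\<^sup>+w. ennreal (indicator A w *\<^sub>R (measure (Q w) B * pmf (q w) u)) \<partial>P)"
      unfolding set_lebesgue_integral_def
      by (rule nn_integral_eq_integral[OF i3, symmetric]) auto
    also have "\<dots> = (\<integral>\<^sup>+w. ennreal (pmf (q w) u) * (\<integral>\<^sup>+x. indicator (A \<times> B) (w, x) \<partial>Q w) \<partial>P)"
    proof (rule nn_integral_cong)
      fix w assume w: "w \<in> space P"
      interpret Qw: prob_space "Q w" by (rule probQ[OF w])
      have "(\<integral>\<^sup>+x. indicator (A \<times> B) (w, x) \<partial>Q w) = (\<integral>\<^sup>+x. indicator A w * indicator B x \<partial>Q w)"
        by (intro nn_integral_cong) (auto simp: indicator_def)
      also have "\<dots> = indicator A w * emeasure (Q w) B"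
        using setsQ[OF w] by (simp add: nn_integral_cmult)
      finally show "ennreal (indicator A w *\<^sub>R (measure (Q w) B * pmf (q w) u))
        = ennreal (pmf (q w) u) * (\<integral>\<^sup>+x. indicator (A \<times> B) (w, x) \<partial>Q w)"
        by (auto simp: indicator_def Qw.emeasure_eq_measure ennreal_mult' mult.commute)
    qed
    also have "\<dots> = (\<integral>\<^sup>+z. indicator (A \<times> B) z \<partial>\<nu> u)"
      using AB by (subst int_\<nu>) auto
    also have "\<dots> = emeasure (\<nu> u) (A \<times> B)"
      using AB by (subst nn_integral_indicator) (simp_all add: sets\<nu>)
    finally show ?thesis .
  qed
  \<comment> \<open>Rectangles are stable under intersection and generate the product. The whole
    space is itself a rectangle of mass at most 1, so a constant sequence serves as the exhausting
    cover.\<close>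
  have eq: "\<mu> u = \<nu> u" for u
  proof (rule measure_eqI_generator_eq[where \<Omega>="space F \<times> space borel" and A="\<lambda>_. space F \<times> space borel"
        and E="{a \<times> b | a b. a \<in> sets F \<and> b \<in> sets (borel :: real measure)}"])
    show "Int_stable {a \<times> b | a b. a \<in> sets F \<and> b \<in> sets (borel :: real measure)}"
      by (rule Int_stable_pair_measure_generator)
    show "{a \<times> b | a b. a \<in> sets F \<and> b \<in> sets (borel :: real measure)} \<subseteq> Pow (space F \<times> space borel)"
      by (rule pair_measure_closed)
    show "sets (\<mu> u) = sigma_sets (space F \<times> space borel) {a \<times> b | a b. a \<in> sets F \<and> b \<in> sets (borel :: real measure)}"
      by (simp add: \<mu>_def sets_pair_measure)
    show "sets (\<nu> u) = sigma_sets (space F \<times> space borel) {a \<times> b | a b. a \<in> sets F \<and> b \<in> sets (borel :: real measure)}"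
      by (simp add: sets\<nu> sets_pair_measure)
    have "emeasure (\<mu> u) (space F \<times> space borel) = (\<integral>\<^sup>+z. indicator (space F \<times> space borel) z \<partial>\<mu> u)"
      by (subst nn_integral_indicator) (auto simp: \<mu>_def)
    also have "\<dots> \<le> (\<integral>\<^sup>+w. 1 \<partial>P)"
      by (subst int_\<mu>) (auto simp: indicator_def simp del: nn_integral_const intro!: borel_measurable_indicator nn_integral_mono)
    finally have "emeasure (\<mu> u) (space F \<times> space borel) \<le> 1"
      by (simp add: P.emeasure_space_1)
    then show "emeasure (\<mu> u) (space F \<times> space borel) \<noteq> \<infinity>" for i :: nat
      by (auto simp: top_unique)
    show "range (\<lambda>_ :: nat. space F \<times> space borel) \<subseteq> {a \<times> b | a b. a \<in> sets F \<and> b \<in> sets (borel :: real measure)}"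
      by (auto intro!: exI[of _ "space P"] exI[of _ "UNIV :: real set"])
    show "(\<Union>i :: nat. space F \<times> space borel) = space F \<times> space (borel :: real measure)"
      by simp
    show "emeasure (\<mu> u) Z = emeasure (\<nu> u) Z"
      if "Z \<in> {a \<times> b | a b. a \<in> sets F \<and> b \<in> sets (borel :: real measure)}" for Z
      using that rect by blast
  qed
  have gu[measurable]: "(\<lambda>(w, x). g (w, x, u)) \<in> borel_measurable (F \<Otimes>\<^sub>M borel)" for u
  proof -
    have "(\<lambda>p. (fst p, snd p, u)) \<in> measurable (F \<Otimes>\<^sub>M borel) (F \<Otimes>\<^sub>M borel \<Otimes>\<^sub>M count_space UNIV)"
      by measurable
    from measurable_compose[OF this g] show ?thesis by (simp add: split_def)
  qed
  have gP: "(\<lambda>w. g (w, r w, u)) \<in> borel_measurable P" for u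
    using measurable_compose[OF _ gu, of "\<lambda>w. (w, r w)" P u] by simp
  \<comment> \<open>Exactly one summand survives, the one with \<open>u = y w\<close>; in each
    summand the last argument of \<open>g\<close> is then a constant.\<close>
  have "(\<integral>\<^sup>+w. g (w, r w, y w) \<partial>P) = (\<integral>\<^sup>+w. (\<Sum>u\<in>UNIV. indicator {u} (y w) * g (w, r w, u)) \<partial>P)"
    by (intro nn_integral_cong) (simp add: indicator_def if_distrib[of "\<lambda>c. c * _"] cong: if_cong)
  also have "\<dots> = (\<Sum>u\<in>UNIV. \<integral>\<^sup>+w. indicator {u} (y w) * g (w, r w, u) \<partial>P)"
    by (rule nn_integral_sum) (use gP in measurable)
  also have "\<dots> = (\<Sum>u\<in>UNIV. \<integral>\<^sup>+z. (\<lambda>(w, x). g (w, x, u)) z \<partial>\<mu> u)"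
    by (simp add: int_\<mu>[OF gu])
  also have "\<dots> = (\<Sum>u\<in>UNIV. \<integral>\<^sup>+w. ennreal (pmf (q w) u) * (\<integral>\<^sup>+x. g (w, x, u) \<partial>Q w) \<partial>P)"
    by (simp add: eq int_\<nu>[OF gu])
  also have "\<dots> = (\<integral>\<^sup>+w. (\<Sum>u\<in>UNIV. ennreal (pmf (q w) u) * (\<integral>\<^sup>+x. g (w, x, u) \<partial>Q w)) \<partial>P)"
  proof (rule nn_integral_sum[symmetric])
    fix u
    have "(\<lambda>w. \<integral>\<^sup>+x. g (w, x, u) \<partial>Q w) \<in> borel_measurable F"
      by (rule nn_integral_measurable_subprob_algebra2[OF gu Q'])
    from FP[OF this] show "(\<lambda>w. ennreal (pmf (q w) u) * (\<integral>\<^sup>+x. g (w, x, u) \<partial>Q w)) \<in> borel_measurable P"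
      by measurable
  qed
  also have "\<dots> = (\<integral>\<^sup>+w. \<integral>\<^sup>+x. \<integral>\<^sup>+u. g (w, x, u) \<partial>q w \<partial>Q w \<partial>P)"
  proof (rule nn_integral_cong)
    fix w assume w: "w \<in> space P"
    have m: "(\<lambda>x. g (w, x, u)) \<in> borel_measurable (Q w)" for u
      using measurable_compose[OF _ gu, of "Pair w" borel u] w by (simp add: measurable_cong_sets[OF setsQ[OF w] refl])
    have "(\<integral>\<^sup>+x. \<integral>\<^sup>+u. g (w, x, u) \<partial>q w \<partial>Q w) = (\<integral>\<^sup>+x. (\<Sum>u\<in>UNIV. ennreal (pmf (q w) u) * g (w, x, u)) \<partial>Q w)"
      by (simp add: nn_integral_measure_pmf nn_integral_count_space_finite)
    also have "\<dots> = (\<Sum>u\<in>UNIV. ennreal (pmf (q w) u) * (\<integral>\<^sup>+x. g (w, x, u) \<partial>Q w))"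
      by (subst nn_integral_sum) (use m in \<open>auto simp: nn_integral_cmult\<close>)
    finally show "(\<Sum>u\<in>UNIV. ennreal (pmf (q w) u) * (\<integral>\<^sup>+x. g (w, x, u) \<partial>Q w))
        = (\<integral>\<^sup>+x. \<integral>\<^sup>+u. g (w, x, u) \<partial>q w \<partial>Q w)" ..
  qed
  finally show ?thesis .
qed

section \<open>History sigma-algebras\<close>

lemma measurable_hist_component:
  assumes "(i, t) \<in> I"
  shows "st X i t \<in> measurable (hist_algebra X I) (count_space UNIV)"
    and "ac X i t \<in> measurable (hist_algebra X I) (count_space UNIV)"
    and "rw X i t \<in> borel_measurable (hist_algebra X I)"
    and "st X i (Suc t) \<in> measurable (hist_algebra X I) (count_space UNIV)"
proof -
  have "(\<lambda>w. (st X i t w, ac X i t w, rw X i t w, st X i (Suc t) w))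
      \<in> measurable (hist_algebra X I) (count_space UNIV \<Otimes>\<^sub>M count_space UNIV \<Otimes>\<^sub>M borel \<Otimes>\<^sub>M count_space UNIV)"
  proof -
    let ?f = "\<lambda>w. \<lambda>i\<in>I. (st X (fst i) (snd i) w, ac X (fst i) (snd i) w, rw X (fst i) (snd i) w,
                      st X (fst i) (Suc (snd i)) w)"
    let ?N = "count_space UNIV \<Otimes>\<^sub>M count_space UNIV \<Otimes>\<^sub>M borel \<Otimes>\<^sub>M count_space UNIV"
    have "?f \<in> measurable (hist_algebra X I) (PiM I (\<lambda>_. ?N))"
      unfolding hist_algebra_def by (rule measurable_vimage_algebra1) (auto simp: space_PiM space_pair_measure)
    from measurable_compose[OF this measurable_component_singleton[OF assms]] assms show ?thesis by simp
  qed
  note c = this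
  show "st X i t \<in> measurable (hist_algebra X I) (count_space UNIV)"
    using measurable_compose[OF c measurable_fst] by simp
  show "ac X i t \<in> measurable (hist_algebra X I) (count_space UNIV)"
    using measurable_compose[OF measurable_compose[OF c measurable_snd] measurable_fst] by simp
  show "rw X i t \<in> borel_measurable (hist_algebra X I)"
    using measurable_compose[OF measurable_compose[OF measurable_compose[OF c measurable_snd] measurable_snd] measurable_fst]
    by simp
  show "st X i (Suc t) \<in> measurable (hist_algebra X I) (count_space UNIV)"
    using measurable_compose[OF measurable_compose[OF measurable_compose[OF c measurable_snd] measurable_snd] measurable_snd]
    by simp
qed

lemma space_hist_algebra [simp]: "space (hist_algebra X I) = space (pspace X)"
  by (simp add: hist_algebra_def)

text \<open>Universal property: a history is the least sigma-algebra making the recorded transitions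
  measurable, so inclusion in \<open>N\<close> can be checked on components. This yields both that
  histories are subalgebras of the probability space and that they increase.\<close>

lemma measurable_ident_hist:
  assumes sp: "space N = space (pspace X)"
    and c: "\<And>i t. (i, t) \<in> I \<Longrightarrow> st X i t \<in> measurable N (count_space UNIV)"
      "\<And>i t. (i, t) \<in> I \<Longrightarrow> ac X i t \<in> measurable N (count_space UNIV)"
      "\<And>i t. (i, t) \<in> I \<Longrightarrow> rw X i t \<in> borel_measurable N"
      "\<And>i t. (i, t) \<in> I \<Longrightarrow> st X i (Suc t) \<in> measurable N (count_space UNIV)"
  shows "(\<lambda>w. w) \<in> measurable N (hist_algebra X I)"
  unfolding hist_algebra_def
proof (rule measurable_vimage_algebra2)
  show "(\<lambda>w. \<lambda>i\<in>I. (st X (fst i) (snd i) w, ac X (fst i) (snd i) w, rw X (fst i) (snd i) w,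
            st X (fst i) (Suc (snd i)) w))
    \<in> measurable N (PiM I (\<lambda>_. count_space UNIV \<Otimes>\<^sub>M count_space UNIV \<Otimes>\<^sub>M borel \<Otimes>\<^sub>M count_space UNIV))"
  proof (rule measurable_restrict)
    fix i assume "i \<in> I"
    then have "(fst i, snd i) \<in> I" by simp
    note [measurable] = c[OF this]
    show "(\<lambda>w. (st X (fst i) (snd i) w, ac X (fst i) (snd i) w, rw X (fst i) (snd i) w,
            st X (fst i) (Suc (snd i)) w))
      \<in> measurable N (count_space UNIV \<Otimes>\<^sub>M count_space UNIV \<Otimes>\<^sub>M borel \<Otimes>\<^sub>M count_space UNIV)"
      by measurable
  qed
qed (simp add: sp)

text \<open>Gives access to the normalization of returns, which \<open>tabular_mdp\<close> states
  for history-dependent policies.\<close>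

lemma induced_in_history_policies:
  assumes "\<And>t s. t \<in> {1..horizon m} \<Longrightarrow> \<rho> t s \<in> measurable borel (count_space UNIV)"
  shows "induced \<rho> 1 b \<in> history_policies m"
  unfolding history_policies_def
proof (intro CollectI ballI allI)
  fix t s a assume t: "t \<in> {1..horizon m}"
  have [measurable]: "(\<lambda>x. b - (\<Sum>u=1..<t. reward_at x u)) \<in> borel_measurable (traj_space {1..<t})"
    by (intro borel_measurable_diff borel_measurable_sum measurable_reward_at[where I="{1..<t}"]) auto
  have "(\<lambda>x. \<rho> t s (b - (\<Sum>u=1..<t. reward_at x u))) \<in> measurable (traj_space {1..<t}) (count_space UNIV)"
    by (rule measurable_compose[OF _ assms[OF t]]) measurable
  from measurable_compose[OF this, of "\<lambda>y. pmf (return_pmf y) a" borel]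
  show "(\<lambda>x. pmf (induced \<rho> 1 b t x s) a) \<in> borel_measurable (traj_space {1..<t})"
    by (simp add: induced_def)
qed

lemma measurable_reward_sum:
  "(\<lambda>z. reward_sum m 1 z) \<in> borel_measurable (rollout_space 1 (horizon m))"
proof -
  have [measurable]: "(\<lambda>z. fst z) \<in> measurable (rollout_space 1 (horizon m)) (traj_space {1..<1 + horizon m})"
    by measurable
  show ?thesis unfolding reward_sum_def
    by (intro borel_measurable_sum measurable_reward_at[where I="{1..<1 + horizon m}"]) auto
qed

lemma tabular_mdp_reward_law: "tabular_mdp m \<Longrightarrow> reward_law m"
  by (simp add: tabular_mdp_def reward_law_def)

section \<open>A single episode, read as a trajectory and compared with a virtual rollout\<close>

locale cvar_ucbvi_episode =
  fixes m :: "('s::finite, 'a::finite) mdp" and K :: nat and \<tau> \<delta> :: real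
    and X :: "('w, 's, 'a) run" and k :: nat
  assumes tabular: "tabular_mdp m" and run: "cvar_ucbvi_run m K \<tau> \<delta> X" and k: "k \<in> {1..K}"
begin

abbreviation H where "H \<equiv> horizon m"
abbreviation P where "P \<equiv> pspace X"
abbreviation F where "F \<equiv> hist_before m X k"
text \<open>The index counts completed stages: \<open>G n\<close> is the information available just
  before the draw of stage \<open>1 + n\<close>.\<close>

abbreviation G where "G n \<equiv> hist_stage m X k (1 + n)"

text \<open>The restriction makes the trajectory \<open>undefined\<close> off the completed stages,
  exactly as in the base case of \<open>rollout\<close>, so that observed and virtual trajectories
  live in the same product space.\<close>

definition observed :: "nat \<Rightarrow> 'w \<Rightarrow> ('s, 'a) traj \<times> 's" where
  "observed n w = (\<lambda>t\<in>{1..<1 + n}. (st X k t w, ac X k t w, rw X k t w), st X k (1 + n) w)"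

definition act :: "nat \<Rightarrow> 'w \<Rightarrow> ('s, 'a) traj \<times> 's \<Rightarrow> 'a" where
  "act n w = next_action (rhohat X k w) 1 (bhat X k w) n"

text \<open>The policy and budget chosen at \<open>w\<close> are frozen and played in a fresh
  rollout: the candidate for the conditional law of \<open>observed n\<close> given the
  past.\<close>

definition virtual :: "nat \<Rightarrow> 'w \<Rightarrow> (('s, 'a) traj \<times> 's) measure" where
  "virtual n w = rollout m (induced (rhohat X k w) 1 (bhat X k w)) 1 (start m) n"

lemma rl: "reward_law m" by (rule tabular_mdp_reward_law[OF tabular])

sublocale P: prob_space P using run by (simp add: cvar_ucbvi_run_def)

lemma run_measurable:
  assumes "i \<in> {1..K}"
  shows "t \<in> {1..Suc H} \<Longrightarrow> st X i t \<in> measurable P (count_space UNIV)"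
    and "t \<in> {1..H} \<Longrightarrow> ac X i t \<in> measurable P (count_space UNIV)"
    and "t \<in> {1..H} \<Longrightarrow> rw X i t \<in> borel_measurable P"
  using run assms by (simp_all add: cvar_ucbvi_run_def)

lemma subalgebra_hist:
  assumes "I \<subseteq> {1..K} \<times> {1..H}"
  shows "subalgebra P (hist_algebra X I)"
proof -
  have "(\<lambda>w. w) \<in> measurable P (hist_algebra X I)"
  proof (rule measurable_ident_hist[OF refl])
    fix i t assume "(i, t) \<in> I"
    then have "i \<in> {1..K}" "t \<in> {1..H}" using assms by auto
    then show "st X i t \<in> measurable P (count_space UNIV)" "ac X i t \<in> measurable P (count_space UNIV)"
      "rw X i t \<in> borel_measurable P" "st X i (Suc t) \<in> measurable P (count_space UNIV)"
      by (auto intro: run_measurable)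
  qed
  from measurable_sets[OF this] show ?thesis
    using sets.sets_into_space[of _ "hist_algebra X I"] by (auto simp: subalgebra_def Int_absorb2)
qed

lemma subalgebra_F: "subalgebra P F"
  unfolding hist_before_def by (rule subalgebra_hist) (use k in auto)

lemma subalgebra_G: "n \<le> H \<Longrightarrow> subalgebra P (G n)"
  unfolding hist_stage_def by (rule subalgebra_hist) (use k in auto)

lemma space_F [simp]: "space F = space P" by (simp add: hist_before_def)

lemma space_hist_stage [simp]: "space (hist_stage m X k h) = space P" by (simp add: hist_stage_def)

text \<open>Says that the history before the episode is contained in each history within it, in the
  form in which it composes with functions measurable for \<open>F\<close>.\<close>

lemma measurable_ident_G_F: "(\<lambda>w. w) \<in> measurable (G n) F"
  unfolding hist_before_def
  by (rule measurable_ident_hist) (auto simp: hist_stage_def intro!: measurable_hist_component)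

lemma rhohat_measurable:
  "t \<in> {1..H} \<Longrightarrow> (\<lambda>(w, b). rhohat X k w t s b) \<in> measurable (F \<Otimes>\<^sub>M borel) (count_space UNIV)"
  and bhat_measurable: "bhat X k \<in> borel_measurable F"
  and bhat_range: "w \<in> space P \<Longrightarrow> bhat X k w \<in> {0..1}"
  using run k by (auto simp: cvar_ucbvi_run_def)

lemma observed_measurable:
  assumes "n \<le> H"
  shows "observed n \<in> measurable (G n) (rollout_space 1 n)"
  unfolding observed_def
proof (rule measurable_Pair)
  show "(\<lambda>w. \<lambda>t\<in>{1..<1 + n}. (st X k t w, ac X k t w, rw X k t w)) \<in> measurable (G n) (traj_space {1..<1 + n})"
    unfolding traj_space_def
  proof (rule measurable_restrict)
    fix t assume "t \<in> {1..<1 + n}"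
    then have "(k, t) \<in> {1..<k} \<times> {1..H} \<union> {k} \<times> {1..<1 + n}" by auto
    note [measurable] = measurable_hist_component[where X=X, OF this, folded hist_stage_def]
    show "(\<lambda>w. (st X k t w, ac X k t w, rw X k t w)) \<in> measurable (G n) step_space"
      unfolding step_space_def by measurable
  qed
  show "st X k (1 + n) \<in> measurable (G n) (count_space UNIV)"
  \<comment> \<open>The current state is recorded only as the successor in the previous transition.
    Before the first stage there is none in this episode, but the state is then the constant
    \<open>start m\<close>.\<close>
  proof (cases n)
    case 0
    have "st X k (1 + n) \<in> measurable (G n) (count_space UNIV) \<longleftrightarrow>
      (\<lambda>_. start m) \<in> measurable (G n) (count_space UNIV)"
      using run k 0 by (intro measurable_cong) (simp add: cvar_ucbvi_run_def)
    then show ?thesis by simp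
  next
    case (Suc j)
    then have "(k, n) \<in> {1..<k} \<times> {1..H} \<union> {k} \<times> {1..<1 + n}" by auto
    from measurable_hist_component(4)[where X=X, OF this] show ?thesis by (simp add: hist_stage_def)
  qed
qed

lemma snd_observed: "snd (observed n w) = st X k (1 + n) w"
  by (simp add: observed_def)

lemma reward_at_observed: "t \<in> {1..<1 + n} \<Longrightarrow> reward_at (fst (observed n w)) t = rw X k t w"
  by (simp add: observed_def reward_at_def)

lemma observed_Suc:
  "observed (Suc n) w =
    ((fst (observed n w))(1 + n := (st X k (1 + n) w, ac X k (1 + n) w, rw X k (1 + n) w)), st X k (Suc (1 + n)) w)"
  by (auto simp: observed_def fun_eq_iff restrict_def)

lemma ac_eq_act:
  assumes "n < H" "w \<in> space P"
  shows "ac X k (1 + n) w = act n w (observed n w)"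
proof -
  have "(\<Sum>t=1..<1 + n. reward_at (fst (observed n w)) t) = (\<Sum>t=1..<1 + n. rw X k t w)"
    by (rule sum.cong[OF refl reward_at_observed])
  moreover have "ac X k (1 + n) w = rhohat X k w (1 + n) (st X k (1 + n) w) (budget X k (1 + n) w)"
    using run k assms by (simp add: cvar_ucbvi_run_def)
  ultimately show ?thesis
    by (simp only: act_def next_action_def snd_observed budget_def)
qed

lemma act_measurable:
  assumes "n < H" "f \<in> measurable M F" "z \<in> measurable M (rollout_space 1 n)"
  shows "(\<lambda>v. act n (f v) (z v)) \<in> measurable M (count_space UNIV)"
  unfolding act_def
  by (rule measurable_next_action[where F=F]) (use assms rhohat_measurable bhat_measurable in auto)

lemma virtual_measurable: "n \<le> H \<Longrightarrow> virtual n \<in> measurable F (prob_algebra (rollout_space 1 n))"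
  unfolding virtual_def[abs_def]
  by (rule measurable_rollout[OF rl _ bhat_measurable]) (auto intro!: rhohat_measurable)

lemma virtual_prob_space: "n \<le> H \<Longrightarrow> w \<in> space P \<Longrightarrow> prob_space (virtual n w)"
  and sets_virtual: "n \<le> H \<Longrightarrow> w \<in> space P \<Longrightarrow> sets (virtual n w) = sets (rollout_space 1 n)"
  using measurable_space[OF virtual_measurable, of n w] by (simp_all only: space_prob_algebra space_F mem_Collect_eq)

section \<open>The law of the observed episode\<close>

lemma nn_integral_observed_Suc:
  assumes n: "n < H" and g: "g \<in> borel_measurable (F \<Otimes>\<^sub>M rollout_space 1 (Suc n))"
  shows "(\<integral>\<^sup>+w. g (w, observed (Suc n) w) \<partial>P) =
    (\<integral>\<^sup>+w. \<integral>\<^sup>+y. g (w, y) \<partial>step_kernel m 1 n (observed n w) (act n w (observed n w)) \<partial>P)"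
proof -
  have obs[measurable]: "observed n \<in> measurable (G n) (rollout_space 1 n)"
    using n by (intro observed_measurable) simp
  note idF[measurable] = measurable_ident_G_F[of n]
  have stG[measurable]: "st X k (1 + n) \<in> measurable (G n) (count_space UNIV)"
    using measurable_compose[OF obs measurable_snd] by (simp add: snd_observed)
  \<comment> \<open>The action of the coming stage is not among the generators of
    \<open>G n\<close>; it is measurable because it is computed from the past policy, the past
    budget and the observed trajectory.\<close>
  have "ac X k (1 + n) \<in> measurable (G n) (count_space UNIV) \<longleftrightarrow>
      (\<lambda>w. act n w (observed n w)) \<in> measurable (G n) (count_space UNIV)"
    by (rule measurable_cong) (use ac_eq_act[OF n] in simp)
  then have acG[measurable]: "ac X k (1 + n) \<in> measurable (G n) (count_space UNIV)"
    using act_measurable[OF n idF obs] by simp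
  have comp: "(\<lambda>w. f (st X k (1 + n) w) (ac X k (1 + n) w)) \<in> measurable (G n) N"
    if "\<And>s a. f s a \<in> space N" for f and N :: "'z measure"
    by (rule measurable_compose_countable[OF measurable_compose_countable[OF measurable_const[OF that] acG] stG])
  \<comment> \<open>Rewrites the integrand as a function of the sample point, the new reward and the
    new state. Everything but the last two is known to \<open>G n\<close>, which is the form
    required for the conditional draw.\<close>
  define g' where "g' p = g (fst p, (fst (observed n (fst p)))(1 + n :=
      (st X k (1 + n) (fst p), ac X k (1 + n) (fst p), fst (snd p))), snd (snd p))" for p
  have "(\<lambda>p. (fst p, (fst (observed n (fst p)))(1 + n :=
      (st X k (1 + n) (fst p), ac X k (1 + n) (fst p), fst (snd p))), snd (snd p)))
    \<in> measurable (G n \<Otimes>\<^sub>M borel \<Otimes>\<^sub>M count_space UNIV) (F \<Otimes>\<^sub>M rollout_space 1 (Suc n))"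
  proof (rule measurable_Pair)
    show "fst \<in> measurable (G n \<Otimes>\<^sub>M borel \<Otimes>\<^sub>M count_space UNIV) F"
      using measurable_compose[OF measurable_fst idF] .
    have "(\<lambda>p. fst (observed n (fst p))) \<in> measurable (G n \<Otimes>\<^sub>M borel \<Otimes>\<^sub>M count_space UNIV) (traj_space {1..<1 + n})"
      using measurable_compose[OF measurable_compose[OF measurable_fst obs] measurable_fst] .
    then show "(\<lambda>p. ((fst (observed n (fst p)))(1 + n :=
      (st X k (1 + n) (fst p), ac X k (1 + n) (fst p), fst (snd p))), snd (snd p)))
      \<in> measurable (G n \<Otimes>\<^sub>M borel \<Otimes>\<^sub>M count_space UNIV) (rollout_space 1 (Suc n))"
      by (rule measurable_extend; (rule measurable_compose[OF measurable_fst stG]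
          | rule measurable_compose[OF measurable_fst acG] | measurable))
  qed
  from measurable_compose[OF this g]
  have g': "g' \<in> borel_measurable (G n \<Otimes>\<^sub>M borel \<Otimes>\<^sub>M count_space UNIV)"
    by (simp add: g'_def[abs_def])
  have "(\<integral>\<^sup>+w. g (w, observed (Suc n) w) \<partial>P) = (\<integral>\<^sup>+w. g' (w, rw X k (1 + n) w, st X k (Suc (1 + n)) w) \<partial>P)"
    by (simp add: g'_def observed_Suc)
  also have "\<dots> = (\<integral>\<^sup>+w. \<integral>\<^sup>+x. \<integral>\<^sup>+u. g' (w, x, u) \<partial>tkernel m (st X k (1 + n) w) (ac X k (1 + n) w)
      \<partial>rlaw m (st X k (1 + n) w) (ac X k (1 + n) w) \<partial>P)"
  proof (rule nn_integral_conditional_draw[OF P.prob_space_axioms _ _ _ _ _ _ g'])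
    show "subalgebra P (G n)" using n by (intro subalgebra_G) simp
    show "rw X k (1 + n) \<in> borel_measurable P" using n k by (intro run_measurable) auto
    show "st X k (Suc (1 + n)) \<in> measurable P (count_space UNIV)" using n k by (intro run_measurable) auto
    show "(\<lambda>w. rlaw m (st X k (1 + n) w) (ac X k (1 + n) w)) \<in> measurable (G n) (prob_algebra borel)"
      by (rule comp[OF reward_law_rlaw[OF rl]])
    show "(\<lambda>w. pmf (tkernel m (st X k (1 + n) w) (ac X k (1 + n) w)) u) \<in> borel_measurable (G n)" for u
      by (rule comp) simp
    show "AE w in P. real_cond_exp P (G n) (\<lambda>v. of_bool (rw X k (1 + n) v \<in> B \<and> st X k (Suc (1 + n)) v = u)) w
        = measure (rlaw m (st X k (1 + n) w) (ac X k (1 + n) w)) B * pmf (tkernel m (st X k (1 + n) w) (ac X k (1 + n) w)) u"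
      if "B \<in> sets borel" for B u
    proof -
      have "1 + n \<in> {1..H}" using n by simp
      with that run k show ?thesis unfolding cvar_ucbvi_run_def by blast
    qed
  qed
  also have "\<dots> = (\<integral>\<^sup>+w. \<integral>\<^sup>+y. g (w, y) \<partial>step_kernel m 1 n (observed n w) (act n w (observed n w)) \<partial>P)"
  proof (rule nn_integral_cong)
    fix w assume w: "w \<in> space P"
    have o: "observed n w \<in> space (rollout_space 1 n)"
      using measurable_space[OF obs] w by simp
    have gw: "(\<lambda>y. g (w, y)) \<in> borel_measurable (rollout_space 1 (Suc n))"
      by (rule measurable_compose[OF measurable_Pair1' g]) (simp add: w)
    show "(\<integral>\<^sup>+x. \<integral>\<^sup>+u. g' (w, x, u) \<partial>tkernel m (st X k (1 + n) w) (ac X k (1 + n) w)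
      \<partial>rlaw m (st X k (1 + n) w) (ac X k (1 + n) w))
      = (\<integral>\<^sup>+y. g (w, y) \<partial>step_kernel m 1 n (observed n w) (act n w (observed n w)))"
      unfolding nn_integral_step_kernel[OF rl o gw]
      by (simp only: snd_observed ac_eq_act[OF n w, symmetric] g'_def fst_conv snd_conv)
  qed
  finally show ?thesis .
qed

text \<open>Integrating out the last stage turns \<open>g\<close> into another jointly measurable
  function of past and shorter trajectory, because the action kernel depends on both. The induction
  therefore runs over all such \<open>g\<close>; the virtual rollout satisfies the same
  recursion.\<close>

lemma nn_integral_observed:
  assumes "n \<le> H" "g \<in> borel_measurable (F \<Otimes>\<^sub>M rollout_space 1 n)"
  shows "(\<integral>\<^sup>+w. g (w, observed n w) \<partial>P) = (\<integral>\<^sup>+w. \<integral>\<^sup>+z. g (w, z) \<partial>virtual n w \<partial>P)"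
  using assms
proof (induction n arbitrary: g)
  case 0
  show ?case
  proof (rule nn_integral_cong)
    fix w assume w: "w \<in> space P"
    have "observed 0 w = (\<lambda>_. undefined, start m)"
      using run k w by (simp add: observed_def cvar_ucbvi_run_def fun_eq_iff)
    moreover have "(\<lambda>y. g (w, y)) \<in> borel_measurable (rollout_space 1 0)"
      by (rule measurable_compose[OF measurable_Pair1' 0(2)]) (simp add: w)
    moreover have "(\<lambda>_. undefined, start m) \<in> space (rollout_space 1 0 :: (('s, 'a) traj \<times> 's) measure)"
      by (simp add: traj_space_def space_pair_measure space_PiM)
    ultimately show "g (w, observed 0 w) = (\<integral>\<^sup>+z. g (w, z) \<partial>virtual 0 w)"
      by (simp add: virtual_def nn_integral_return)
  qed
next
  case (Suc n)
  then have n: "n < H" "n \<le> H" by auto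
  define L where "L p = step_kernel m 1 n (snd p) (act n (fst p) (snd p))" for p
  have Lp: "L \<in> measurable (F \<Otimes>\<^sub>M rollout_space 1 n) (prob_algebra (rollout_space 1 (Suc n)))"
    unfolding L_def[abs_def] by (intro measurable_step_kernel rl act_measurable n) auto
  note L = measurable_prob_algebraD[OF Lp]
  define g' where "g' p = (\<integral>\<^sup>+y. g (fst p, y) \<partial>L p)" for p
  have "(\<lambda>(p, y). g (fst p, y)) \<in> borel_measurable ((F \<Otimes>\<^sub>M rollout_space 1 n) \<Otimes>\<^sub>M rollout_space 1 (Suc n))"
  proof -
    have "(\<lambda>q. (fst (fst q), snd q)) \<in>
        measurable ((F \<Otimes>\<^sub>M rollout_space 1 n) \<Otimes>\<^sub>M rollout_space 1 (Suc n)) (F \<Otimes>\<^sub>M rollout_space 1 (Suc n))"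
      by measurable
    from measurable_compose[OF this Suc.prems(2)] show ?thesis by (simp add: split_def)
  qed
  from nn_integral_measurable_subprob_algebra2[OF this L]
  have g': "g' \<in> borel_measurable (F \<Otimes>\<^sub>M rollout_space 1 n)"
    by (simp add: g'_def[abs_def])
  have "(\<integral>\<^sup>+w. g (w, observed (Suc n) w) \<partial>P) = (\<integral>\<^sup>+w. g' (w, observed n w) \<partial>P)"
    using nn_integral_observed_Suc[OF n(1) Suc.prems(2)] by (simp add: g'_def L_def)
  also have "\<dots> = (\<integral>\<^sup>+w. \<integral>\<^sup>+z. g' (w, z) \<partial>virtual n w \<partial>P)"
    by (rule Suc.IH[OF n(2) g'])
  also have "\<dots> = (\<integral>\<^sup>+w. \<integral>\<^sup>+y. g (w, y) \<partial>virtual (Suc n) w \<partial>P)"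
  proof (rule nn_integral_cong)
    fix w assume w: "w \<in> space P"
    note v = sets_virtual[OF n(2) w]
    have gw: "(\<lambda>y. g (w, y)) \<in> borel_measurable (rollout_space 1 (Suc n))"
      by (rule measurable_compose[OF measurable_Pair1' Suc.prems(2)]) (simp add: w)
    have "(\<lambda>z. L (w, z)) \<in> measurable (rollout_space 1 n) (subprob_algebra (rollout_space 1 (Suc n)))"
      by (rule measurable_compose[OF measurable_Pair1' L]) (simp add: w)
    then have Lw: "(\<lambda>z. L (w, z)) \<in> measurable (virtual n w) (subprob_algebra (rollout_space 1 (Suc n)))"
      by (simp only: measurable_cong_sets[OF v refl])
    have "virtual (Suc n) w = virtual n w \<bind> (\<lambda>z. L (w, z))"
      unfolding virtual_def L_def act_def fst_conv snd_conv
      by (rule rollout_induced_Suc[OF rl v[unfolded virtual_def]])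
    then show "(\<integral>\<^sup>+z. g' (w, z) \<partial>virtual n w) = (\<integral>\<^sup>+y. g (w, y) \<partial>virtual (Suc n) w)"
      using nn_integral_bind[OF gw Lw] by (simp add: g'_def)
  qed
  finally show ?case .
qed

section \<open>The conditional mean of the shortfall\<close>

definition policy_value :: "'w \<Rightarrow> real" where
  "policy_value w = sf_value m (rhohat X k w) 1 (start m) (bhat X k w)"

lemma horizon_pos: "1 \<le> H"
  using tabular by (simp add: tabular_mdp_def)

lemma virtual_reward_sum:
  assumes "w \<in> space P"
  shows "AE z in virtual H w. reward_sum m 1 z \<in> {0..1}"
proof -
  have "rhohat X k w t s \<in> measurable borel (count_space UNIV)" if "t \<in> {1..H}" for t s
    using measurable_compose[OF measurable_Pair1' rhohat_measurable[OF that], of w s] assms by simp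
  then have "induced (rhohat X k w) 1 (bhat X k w) \<in> history_policies m"
    by (rule induced_in_history_policies)
  then show ?thesis using tabular unfolding tabular_mdp_def virtual_def by blast
qed

lemma measurable_budget_reward_sum:
  "(\<lambda>(w, z). max 0 (bhat X k w - reward_sum m 1 z)) \<in> borel_measurable (F \<Otimes>\<^sub>M rollout_space 1 H)"
proof -
  note [measurable] = bhat_measurable measurable_reward_sum[of m]
  show ?thesis by measurable
qed

lemma ennreal_policy_value:
  assumes w: "w \<in> space P"
  shows "ennreal (policy_value w) = (\<integral>\<^sup>+z. ennreal (max 0 (bhat X k w - reward_sum m 1 z)) \<partial>virtual H w)"
    and "policy_value w \<in> {0..1}"
proof -
  interpret V: prob_space "virtual H w" by (rule virtual_prob_space[OF order_refl w])
  have ae: "AE z in virtual H w. max 0 (bhat X k w - reward_sum m 1 z) \<in> {0..1}"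
    using virtual_reward_sum[OF w] by eventually_elim (use bhat_range[OF w] in auto)
  have "(\<lambda>z. reward_sum m 1 z) \<in> borel_measurable (virtual H w)"
    using measurable_reward_sum[of m] by (simp only: measurable_cong_sets[OF sets_virtual[OF order_refl w] refl])
  then have i: "integrable (virtual H w) (\<lambda>z. max 0 (bhat X k w - reward_sum m 1 z))"
    using ae by (intro V.integrable_const_bound[where B=1]) auto
  have v: "policy_value w = (\<integral>z. max 0 (bhat X k w - reward_sum m 1 z) \<partial>virtual H w)"
    by (simp add: policy_value_def sf_value_def virtual_def)
  show "ennreal (policy_value w) = (\<integral>\<^sup>+z. ennreal (max 0 (bhat X k w - reward_sum m 1 z)) \<partial>virtual H w)"
    unfolding v by (rule nn_integral_eq_integral[symmetric, OF i]) simp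
  have "policy_value w \<le> (\<integral>z. 1 \<partial>virtual H w)"
    unfolding v using ae by (intro integral_mono_AE i) auto
  then show "policy_value w \<in> {0..1}"
    unfolding v by (simp add: V.prob_space)
qed

text \<open>Nonnegative integrals against a kernel are measurable in the parameter. The value lies
  in the unit interval, so \<open>enn2real\<close> recovers it without loss.\<close>

lemma policy_value_measurable: "policy_value \<in> borel_measurable F"
proof -
  have "(\<lambda>(w, z). ennreal (max 0 (bhat X k w - reward_sum m 1 z))) \<in> borel_measurable (F \<Otimes>\<^sub>M rollout_space 1 H)"
    using measurable_compose[OF measurable_budget_reward_sum measurable_ennreal] by (simp add: split_def)
  from nn_integral_measurable_subprob_algebra2[OF this measurable_prob_algebraD[OF virtual_measurable]]
  have "(\<lambda>w. enn2real (\<integral>\<^sup>+z. ennreal (max 0 (bhat X k w - reward_sum m 1 z)) \<partial>virtual H w)) \<in> borel_measurable F"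
    by (intro borel_measurable_enn2real) auto
  moreover have "policy_value w = enn2real (\<integral>\<^sup>+z. ennreal (max 0 (bhat X k w - reward_sum m 1 z)) \<partial>virtual H w)"
    if "w \<in> space F" for w
    using ennreal_policy_value[of w] that by (metis atLeastAtMost_iff enn2real_ennreal space_F)
  ultimately show ?thesis by (subst measurable_cong) auto
qed

lemma reward_sum_observed: "reward_sum m 1 (observed H w) = (\<Sum>t=1..H. rw X k t w)"
  unfolding reward_sum_def by (rule sum.cong[OF refl]) (auto intro: reward_at_observed)

lemma AE_return: "AE w in P. (\<Sum>t=1..H. rw X k t w) \<in> {0..1}"
proof -
  note [measurable] = measurable_reward_sum[of m]
  \<comment> \<open>The indicator of a return outside the unit interval. Its integral vanishes under
    every virtual rollout, hence also along the run.\<close>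
  define g :: "'w \<times> ('s, 'a) traj \<times> 's \<Rightarrow> ennreal"
    where "g p = indicator (- {0..1}) (reward_sum m 1 (snd p))" for p
  have "g \<in> borel_measurable (F \<Otimes>\<^sub>M rollout_space 1 H)"
    unfolding g_def by measurable
  from nn_integral_observed[OF order_refl this]
  have "(\<integral>\<^sup>+w. indicator (- {0..1}) (\<Sum>t=1..H. rw X k t w) \<partial>P)
      = (\<integral>\<^sup>+w. \<integral>\<^sup>+z. g (w, z) \<partial>virtual H w \<partial>P)"
    by (simp only: g_def snd_conv reward_sum_observed)
  also have "\<dots> = (\<integral>\<^sup>+w. 0 \<partial>P)"
  proof (rule nn_integral_cong)
    fix w assume "w \<in> space P"
    have "(\<integral>\<^sup>+z. g (w, z) \<partial>virtual H w) = (\<integral>\<^sup>+z. 0 \<partial>virtual H w)"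
      by (rule nn_integral_cong_AE, rule AE_mp[OF virtual_reward_sum[OF \<open>w \<in> space P\<close>]]) (simp add: g_def)
    then show "(\<integral>\<^sup>+z. g (w, z) \<partial>virtual H w) = 0" by simp
  qed
  finally have 0: "(\<integral>\<^sup>+w. indicator (- {0..1}) (\<Sum>t=1..H. rw X k t w) \<partial>P) = 0" by simp
  have "(\<lambda>w. \<Sum>t=1..H. rw X k t w) \<in> borel_measurable P"
    using k by (intro borel_measurable_sum run_measurable) auto
  from measurable_compose[OF this, of "indicator (- {0..1})" borel]
  have "(\<lambda>w. indicator (- {0..1}) (\<Sum>t=1..H. rw X k t w) :: ennreal) \<in> borel_measurable P" by simp
  then have "AE w in P. (indicator (- {0..1}) (\<Sum>t=1..H. rw X k t w) :: ennreal) = 0"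
    using 0 by (subst (asm) nn_integral_0_iff_AE) simp_all
  then show ?thesis by eventually_elim (auto simp: indicator_def split: if_splits)
qed

lemma shortfall_measurable: "shortfall m X k \<in> borel_measurable P"
proof -
  have [measurable]: "bhat X k \<in> borel_measurable P"
    by (rule measurable_from_subalg[OF subalgebra_F bhat_measurable])
  have [measurable]: "(\<lambda>w. \<Sum>t=1..H. rw X k t w) \<in> borel_measurable P"
    using k by (intro borel_measurable_sum run_measurable) auto
  show ?thesis unfolding shortfall_def[abs_def] by measurable
qed

lemma shortfall_nonneg: "0 \<le> shortfall m X k w"
  by (simp add: shortfall_def)

lemma AE_shortfall: "AE w in P. shortfall m X k w \<in> {0..1}"
  using AE_return AE_space by eventually_elim (use bhat_range in \<open>fastforce simp: shortfall_def\<close>)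

sublocale FP: finite_measure_subalgebra P F
  by unfold_locales (rule subalgebra_F)

lemma cond_exp_shortfall: "AE w in P. real_cond_exp P F (shortfall m X k) w = policy_value w"
proof (rule FP.real_cond_exp_charact)
  show "integrable P (shortfall m X k)"
    by (rule P.integrable_const_bound[where B=1]) (use AE_shortfall shortfall_measurable in auto)
  have pvP[measurable]: "policy_value \<in> borel_measurable P"
    by (rule measurable_from_subalg[OF subalgebra_F policy_value_measurable])
  show "integrable P policy_value"
    by (rule P.integrable_const_bound[where B=1]) (use ennreal_policy_value(2) pvP in auto)
  show "policy_value \<in> borel_measurable F" by (rule policy_value_measurable)
  fix A assume A[measurable]: "A \<in> sets F"
  have [measurable]: "A \<in> sets P" using A subalgebra_F by (auto simp: subalgebra_def)
  note [measurable] = shortfall_measurable measurable_budget_reward_sum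
  \<comment> \<open>The test set \<open>A\<close> depends on the first coordinate only, so the
    virtual rollout at \<open>w\<close> leaves it alone and integrates the shortfall to
    \<open>policy_value w\<close>.\<close>
  define g :: "'w \<times> ('s, 'a) traj \<times> 's \<Rightarrow> ennreal"
    where "g p = indicator A (fst p) * ennreal ((\<lambda>(w, z). max 0 (bhat X k w - reward_sum m 1 z)) p)" for p
  have g: "g \<in> borel_measurable (F \<Otimes>\<^sub>M rollout_space 1 H)"
    unfolding g_def by measurable
  have "(\<integral>\<^sup>+w. ennreal (indicator A w *\<^sub>R shortfall m X k w) \<partial>P) = (\<integral>\<^sup>+w. g (w, observed H w) \<partial>P)"
    by (simp only: g_def split fst_conv reward_sum_observed shortfall_def)
       (auto intro!: nn_integral_cong simp: indicator_def)
  also have "\<dots> = (\<integral>\<^sup>+w. \<integral>\<^sup>+z. g (w, z) \<partial>virtual H w \<partial>P)"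
    by (rule nn_integral_observed[OF order_refl g])
  also have "\<dots> = (\<integral>\<^sup>+w. ennreal (indicator A w *\<^sub>R policy_value w) \<partial>P)"
    by (rule nn_integral_cong) (auto simp: g_def ennreal_policy_value indicator_def)
  finally show "(\<integral>w\<in>A. shortfall m X k w \<partial>P) = (\<integral>w\<in>A. policy_value w \<partial>P)"
    unfolding set_lebesgue_integral_def using ennreal_policy_value(2)
    by (subst (1 2) integral_eq_nn_integral) (use shortfall_measurable pvP in \<open>auto simp: shortfall_nonneg\<close>)
qed

end

section \<open>Conditional variance of a variable in the unit interval\<close>

text \<open>Let c be the conditional mean. Since f^2 \<le> f, the square (f - c)^2 is at most f - 2
  c f + c^2. Pulling the measurable factor c out, the right side has conditional mean c - c^2 \<le>
  c.\<close>

lemma (in finite_measure_subalgebra) cond_var_le_cond_exp: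
  assumes f[measurable]: "f \<in> borel_measurable M" and f01: "AE w in M. f w \<in> {0..1}"
  shows "AE w in M. cond_var M F f w \<le> real_cond_exp M F f w"
proof -
  \<comment> \<open>The constant 9 is mere slack: the functions to which this is applied are bounded
    by 1 almost everywhere.\<close>
  have bounded: "integrable M g" if "AE w in M. \<bar>g w\<bar> \<le> 9" "g \<in> borel_measurable M" for g :: "'a \<Rightarrow> real"
    using that by (intro integrable_const_bound[where B=9]) auto
  define c where "c = real_cond_exp M F f"
  have cF[measurable]: "c \<in> borel_measurable F" by (simp add: c_def)
  have cM[measurable]: "c \<in> borel_measurable M" by (simp add: c_def)
  have fi: "integrable M f" by (rule bounded) (use f01 in auto)
  have c01: "AE w in M. c w \<in> {0..1}"
    using real_cond_exp_ge_c[OF fi, of 0] real_cond_exp_le_c[OF fi, of 1] f01 by (auto simp: c_def)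
  have bd: "AE w in M. \<bar>c w * f w\<bar> \<le> 1 \<and> \<bar>c w * c w\<bar> \<le> 1 \<and> \<bar>(f w - c w)\<^sup>2\<bar> \<le> 1"
    using f01 c01 by eventually_elim (auto simp: abs_mult intro!: mult_le_one abs_square_le_1[THEN iffD2])
  have cf: "integrable M (\<lambda>w. c w * f w)" and cc: "integrable M (\<lambda>w. c w * c w)"
    and sq: "integrable M (\<lambda>w. (f w - c w)\<^sup>2)"
    by (rule bounded; use bd in force)+
  have E1: "AE w in M. real_cond_exp M F (\<lambda>w. c w * f w) w = c w * c w"
    using real_cond_exp_mult[OF cF f cf] by (simp add: c_def)
  have E2: "AE w in M. real_cond_exp M F (\<lambda>w. c w * c w) w = c w * c w"
    by (rule real_cond_exp_F_meas[OF cc]) measurable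
  have le: "AE w in M. (f w - c w)\<^sup>2 \<le> f w - (2 * (c w * f w) - c w * c w)"
    using f01
  proof eventually_elim
    case (elim w)
    have "f w * f w \<le> f w * 1" using elim by (intro mult_left_mono) auto
    then show ?case by (simp add: power2_eq_square algebra_simps)
  qed
  have "AE w in M. real_cond_exp M F (\<lambda>w. (f w - c w)\<^sup>2) w
      \<le> real_cond_exp M F (\<lambda>w. f w - (2 * (c w * f w) - c w * c w)) w"
    by (rule real_cond_exp_mono[OF le sq]) (use fi cf cc in auto)
  moreover have "AE w in M. real_cond_exp M F (\<lambda>w. f w - (2 * (c w * f w) - c w * c w)) w
      = c w - real_cond_exp M F (\<lambda>w. 2 * (c w * f w) - c w * c w) w"
    unfolding c_def[symmetric] using real_cond_exp_diff[OF fi, of "\<lambda>w. 2 * (c w * f w) - c w * c w"] cf cc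
    by (simp add: c_def)
  moreover have "AE w in M. real_cond_exp M F (\<lambda>w. 2 * (c w * f w) - c w * c w) w
      = real_cond_exp M F (\<lambda>w. 2 * (c w * f w)) w - real_cond_exp M F (\<lambda>w. c w * c w) w"
    by (rule real_cond_exp_diff) (use cf cc in auto)
  moreover have "AE w in M. real_cond_exp M F (\<lambda>w. 2 * (c w * f w)) w = 2 * real_cond_exp M F (\<lambda>w. c w * f w) w"
    by (rule real_cond_exp_cmult[OF cf])
  ultimately have "AE w in M. real_cond_exp M F (\<lambda>w. (f w - c w)\<^sup>2) w \<le> c w"
    using E1 E2 by eventually_elim (smt (verit) zero_le_square)
  then show ?thesis by (simp add: cond_var_def c_def)
qed

section \<open>Optimism at budget zero and the conclusion\<close>

lemma sf_value_opt_zero_budget_le: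
  assumes "tabular_mdp m"
  shows "sf_value_opt m 1 (start m) 0 \<le> 0"
proof -
  \<comment> \<open>Nonnegative returns leave no shortfall at budget 0 under any policy, so one
    measurable policy suffices to bound the infimum. A constant one is measurable, and its
    unspecified action is harmless.\<close>
  define \<rho> :: "('a, 'b) aug_policy" where "\<rho> = (\<lambda>_ _ _. undefined)"
  have "\<rho> \<in> aug_policies m" by (simp add: aug_policies_def \<rho>_def)
  moreover have "induced \<rho> 1 0 \<in> history_policies m"
    by (rule induced_in_history_policies) (simp add: \<rho>_def)
  then have "AE z in rollout m (induced \<rho> 1 0) 1 (start m) (horizon m). reward_sum m 1 z \<in> {0..1}"
    using assms unfolding tabular_mdp_def by blast
  then have "sf_value m \<rho> 1 (start m) 0 = 0"
    unfolding sf_value_def diff_Suc_1 by (intro integral_eq_zero_AE) (auto elim!: eventually_mono)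
  moreover have "bdd_below ((\<lambda>\<rho>. sf_value m \<rho> 1 (start m) 0) ` aug_policies m)"
    by (rule bdd_belowI[where m=0]) (auto simp: sf_value_def)
  ultimately show ?thesis
    unfolding sf_value_opt_def by (metis cINF_lower)
qed

text \<open>Lower values and budgets are genuine functions of the sample point, so their bounds hold
  at every point of the event. Conditional expectations are fixed only up to null sets, hence the
  almost-everywhere form of the other bounds.\<close>

theorem lemma3p1:
  fixes m :: "('s::finite, 'a::finite) mdp" and X :: "('w, 's, 'a) run"
    and K :: nat and \<tau> \<delta> :: real
  assumes "tabular_mdp m"
    and "0 < \<tau>" and "\<tau> \<le> 1" and "0 < \<delta>" and "\<delta> < 1"
    and "cvar_ucbvi_run m K \<tau> \<delta> X"
  shows "(\<forall>w\<in>good_event m K \<tau> \<delta> X. \<forall>k\<in>{1..K}.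
            v_down m K \<delta> X 1 k w (start m) (bhat X k w) \<le> \<tau> * bhat X k w
            \<and> \<tau> * bhat X k w \<le> \<tau>)
       \<and> (AE w in pspace X. w \<in> good_event m K \<tau> \<delta> X \<longrightarrow>
            (\<forall>k\<in>{1..K}.
               cond_var (pspace X) (hist_before m X k) (shortfall m X k) w
                 \<le> real_cond_exp (pspace X) (hist_before m X k) (shortfall m X k) w
               \<and> real_cond_exp (pspace X) (hist_before m X k) (shortfall m X k) w
                 \<le> \<tau> + val_gap m K \<delta> X k w))"
proof -
  have 1: "v_down m K \<delta> X 1 k w (start m) (bhat X k w) \<le> \<tau> * bhat X k w \<and> \<tau> * bhat X k w \<le> \<tau>"
    if w: "w \<in> good_event m K \<tau> \<delta> X" and k: "k \<in> {1..K}" for w k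
  proof -
    have sp: "w \<in> space (pspace X)" using w by (simp add: good_event_def Let_def)
    interpret cvar_ucbvi_episode m K \<tau> \<delta> X k by unfold_locales fact+
    have "1 \<in> {1..horizon m}" using horizon_pos by simp
    moreover have "(0::real) \<in> {..1}" by simp
    ultimately have "v_down m K \<delta> X 1 k w (start m) 0 \<le> sf_value_opt m 1 (start m) 0"
      using w k unfolding good_event_def Let_def by blast
    then have v0: "v_down m K \<delta> X 1 k w (start m) 0 \<le> 0"
      using sf_value_opt_zero_budget_le[OF assms(1)] by simp
    have "f_hat m K \<tau> \<delta> X k w 0 \<le> f_hat m K \<tau> \<delta> X k w (bhat X k w)"
      using assms(6) k sp by (simp add: cvar_ucbvi_run_def)
    \<comment> \<open>Makes the objective at budget 0 nonnegative; its maximum, attained at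
      \<open>bhat\<close>, is then nonnegative too.\<close>
    moreover have "v_down m K \<delta> X 1 k w (start m) 0 / \<tau> \<le> 0"
      using v0 assms(2) by (simp add: divide_le_0_iff)
    ultimately have "v_down m K \<delta> X 1 k w (start m) (bhat X k w) / \<tau> \<le> bhat X k w"
      by (simp add: f_hat_def)
    then show ?thesis
      using bhat_range[OF sp] assms(2) by (simp add: divide_le_eq mult.commute)
  qed
  moreover have "AE w in pspace X. w \<in> good_event m K \<tau> \<delta> X \<longrightarrow>
      cond_var (pspace X) (hist_before m X k) (shortfall m X k) w
        \<le> real_cond_exp (pspace X) (hist_before m X k) (shortfall m X k) w
      \<and> real_cond_exp (pspace X) (hist_before m X k) (shortfall m X k) w \<le> \<tau> + val_gap m K \<delta> X k w"
    if k: "k \<in> {1..K}" for k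
  proof -
    interpret cvar_ucbvi_episode m K \<tau> \<delta> X k by unfold_locales fact+
    show ?thesis
      using cond_exp_shortfall FP.cond_var_le_cond_exp[OF shortfall_measurable AE_shortfall]
    proof eventually_elim
      case (elim w)
      then show ?case using 1[of w k] k by (auto simp: val_gap_def policy_value_def)
    qed
  qed
  \<comment> \<open>There are finitely many episodes, so their exceptional null sets merge into
    one.\<close>
  then have "AE w in pspace X. \<forall>k\<in>{1..K}. w \<in> good_event m K \<tau> \<delta> X \<longrightarrow>
      cond_var (pspace X) (hist_before m X k) (shortfall m X k) w
        \<le> real_cond_exp (pspace X) (hist_before m X k) (shortfall m X k) w
      \<and> real_cond_exp (pspace X) (hist_before m X k) (shortfall m X k) w \<le> \<tau> + val_gap m K \<delta> X k w"
    by (intro AE_finite_allI) auto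
  ultimately show ?thesis by (auto elim!: eventually_mono)
qed

end
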